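(* There exists a universal constant $c>0$ such that the following holds. Let $\{\phi(\cdot,w):\mathscr{X}\to\{0,1\}\}_{w\in\mathscr{W}}$ be a family of binary classifiers such that the induced class of sets $\mathscr{C}_{\mathscr{W}}=\{\mathscr{C}_w:w\in\mathscr{W}\}$, $\mathscr{C}_w=\{x\in\mathscr{X}:\phi(x,w)=1\}$, is a VC class with VC dimension $D$. Then, for i.i.d. data $(X_1,Y_1),\ldots,(X_n,Y_n)$ from any distribution on $\mathscr{X}\times\{0,1\}$, the excess risk of the empirical risk minimizer satisfies $$\mathsf{E}\Big(L(w_{\mathrm{ERM}})-\inf_{w\in\mathscr{W}}L(w)\Big)\le c\sqrt{\frac{D}{n}} .$$
   Context: The loss is the $0$-$1$ loss $\ell((x,y),w)=\mathbb{1}_{\{y\ne\phi(x,w)\}}$. The risk is $L(w)=\mathsf{Pr}\{Y\ne\phi(X,w)\}$ with $(X,Y)$ drawn from the data distribution, the empirical risk is $L_n(w)=\frac1n\sum_{i=1}^n\mathbb{1}_{\{Y_i\ne\phi(X_i,w)\}}$, and $w_{\mathrm{ERM}}\in\arg\min_{w\in\mathscr{W}}L_n(w)$ is an empirical risk minimizer (a measurable function of the data); $L(w_{\mathrm{ERM}})$ is $L$ evaluated at $w_{\mathrm{ERM}}$ and the expectation is over the data. Suprema over $\mathscr{W}$ of the data-dependent quantities involved are assumed measurable. For a class $\mathscr{C}$ of measurable subsets of $\mathscr{X}$, the $n$th shatter coefficient is $S_n(\mathscr{C})=\max_{x_1,\ldots,x_n\in\mathscr{X}}|\{(\mathbb{1}_{\{x_1\in\mathscr{A}\}},\ldots,\mathbb{1}_{\{x_n\in\mathscr{A}\}}):\mathscr{A}\in\mathscr{C}\}|$.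 The VC dimension of $\mathscr{C}$ is the largest integer $n\ge1$ with $S_n(\mathscr{C})=2^n$ (infinite if this holds for all $n$); $\mathscr{C}$ is a VC class if its VC dimension is finite. *)

theory Defs
  imports "HOL-Probability.Probability"
begin

text \<open>Labels in $\{0,1\}$ are of type \<^typ>\<open>bool\<close>, with \<^term>\<open>True\<close> in the role of $1$.
  Samples of size \<open>n\<close> are indexed by \<^term>\<open>{..<n}\<close>.\<close>

abbreviation example_space :: "'x measure \<Rightarrow> ('x \<times> bool) measure" where
  "example_space M \<equiv> M \<Otimes>\<^sub>M count_space UNIV"

abbreviation sample_space :: "'x measure \<Rightarrow> nat \<Rightarrow> (nat \<Rightarrow> 'x \<times> bool) measure" where
  "sample_space M n \<equiv> PiM {..<n} (\<lambda>_. example_space M)"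

definition zero_one_loss :: "('x \<Rightarrow> 'w \<Rightarrow> bool) \<Rightarrow> 'x \<times> bool \<Rightarrow> 'w \<Rightarrow> real" where
  "zero_one_loss \<phi> z w = of_bool (snd z \<noteq> \<phi> (fst z) w)"

definition risk :: "('x \<times> bool) measure \<Rightarrow> ('x \<Rightarrow> 'w \<Rightarrow> bool) \<Rightarrow> 'w \<Rightarrow> real" where
  "risk P \<phi> w = measure P {z \<in> space P. snd z \<noteq> \<phi> (fst z) w}"

definition empirical_risk ::
    "('x \<Rightarrow> 'w \<Rightarrow> bool) \<Rightarrow> nat \<Rightarrow> (nat \<Rightarrow> 'x \<times> bool) \<Rightarrow> 'w \<Rightarrow> real" where
  "empirical_risk \<phi> n z w = (1 / real n) * (\<Sum>i<n. zero_one_loss \<phi> (z i) w)"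

definition classifier_sets :: "'x set \<Rightarrow> ('x \<Rightarrow> 'w \<Rightarrow> bool) \<Rightarrow> 'w set \<Rightarrow> 'x set set" where
  "classifier_sets S \<phi> W = (\<lambda>w. {x \<in> S. \<phi> x w}) ` W"

definition shatter_coeff :: "'x set \<Rightarrow> 'x set set \<Rightarrow> nat \<Rightarrow> nat" where
  "shatter_coeff S C n =
     Max ((\<lambda>x. card ((\<lambda>A. \<lambda>i\<in>{..<n}. x i \<in> A) ` C)) ` ({..<n} \<rightarrow>\<^sub>E S))"

text \<open>The supremum in \<^typ>\<open>enat\<close> is the maximum of a finite nonempty set and \<open>\<infinity>\<close> for an infinite
  one; since shattering is inherited by smaller sample sizes, the latter means
  that all \<open>n\<close> qualify. If no \<open>n \<ge> 1\<close> qualifies, the value is \<open>0\<close>.\<close>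

definition vc_dim :: "'x set \<Rightarrow> 'x set set \<Rightarrow> enat" where
  "vc_dim S C = Sup {enat n |n. n \<ge> 1 \<and> shatter_coeff S C n = 2 ^ n}"

text \<open>The suprema over the index set that occur when the excess risk is bounded by the uniform
  deviation of the empirical risk and the latter is symmetrized: the uniform deviation itself, and
  the Rademacher supremum for each fixed choice of signs. An assumption of this kind cannot be
  dropped: if \<^term>\<open>M\<close> is the unit interval and, under the continuum hypothesis, the class consists
  of the (countable) initial segments of a well-order of type $\omega_1$ together with the whole
  interval, the VC dimension is $1$ while an empirical risk minimizer can have excess risk $1$.\<close>

definition measurable_suprema ::
    "'x measure \<Rightarrow> ('x \<times> bool) measure \<Rightarrow> ('x \<Rightarrow> 'w \<Rightarrow> bool) \<Rightarrow> 'w set \<Rightarrow> nat \<Rightarrow> bool" where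
  "measurable_suprema M P \<phi> W n \<longleftrightarrow>
     (\<lambda>z. SUP w\<in>W. \<bar>empirical_risk \<phi> n z w - risk P \<phi> w\<bar>) \<in> borel_measurable (sample_space M n) \<and>
     (\<forall>\<epsilon> \<in> {..<n} \<rightarrow> {-1, 1::real}.
        (\<lambda>z. SUP w\<in>W. \<bar>(1 / real n) * (\<Sum>i<n. \<epsilon> i * zero_one_loss \<phi> (z i) w)\<bar>)
          \<in> borel_measurable (sample_space M n))"

text \<open>A constant quantified existentially inside a HOL proposition may depend on the type
  variables of that proposition. A cap that mentions no type makes it universal: the bound then
  holds with this single number for all types. Its value is of no significance.\<close>

definition universal_cap :: real where
  "universal_cap = 10000"

end

theory Submission
  imports Defs
begin

text \<open>The excess risk is at most twice the uniform deviation of the empirical risk. For a fixed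
  choice of signs \<open>\<epsilon>\<close>, the deviation splits into the parts over \<open>\<epsilon> = 1\<close> and \<open>\<epsilon> = -1\<close>; averaging
  over the other half of the sample bounds each part by the expected Rademacher supremum for \<open>\<epsilon>\<close>
  plus \<open>\<bar>\<Sum>i. \<epsilon> i\<bar> / n\<close>. Averaging over all signs then reduces the theorem to a Rademacher average
  of a set system of VC dimension \<open>D\<close> on \<open>n\<close> points. There, chaining through maximal
  \<open>n / 4 ^ j\<close>-separated subfamilies avoids a logarithm, because by Dudley's packing bound the
  logarithm of the size of such a subfamily is at most a multiple of \<open>D * (j + 1)\<close>.\<close>

section \<open>Sauer--Shelah and packing\<close>

text \<open>The class can be uncountable, so measurability of suprema is available only as far as
  \<open>measurable_suprema\<close> goes: for the uniform deviation and for the Rademacher supremum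
  at each fixed choice of signs. The usual symmetrization also forms a supremum over differences of
  two independent samples, about which nothing is assumed; this is why the signs themselves cut the
  one sample in two. The price is that a signed sum of losses is not centred when the halves differ
  in size. Averaged over the signs, the imbalance has order \<open>sqrt n\<close> and costs order
  \<open>1 / sqrt n\<close>, which \<open>sqrt (D / n)\<close> absorbs once
  \<open>D \<ge> 1\<close>; the case \<open>D = 0\<close> is treated exactly. A single union bound
  over all error patterns on the sample would leave a factor growing with \<open>n\<close>. Along
  the chain, the Euclidean length of a link halves at each level while the logarithm of the number
  of links grows only linearly, so the contributions form a convergent series.\<close>

definition shatters :: "'a set set \<Rightarrow> 'a set \<Rightarrow> bool" where
  "shatters F B \<longleftrightarrow> (\<forall>C\<subseteq>B. \<exists>A\<in>F. A \<inter> B = C)"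

lemma shattersE:
  assumes "shatters F B" "C \<subseteq> B"
  obtains A where "A \<in> F" "A \<inter> B = C"
proof -
  have "\<exists>A\<in>F. A \<inter> B = C" using assms by (simp add: shatters_def)
  then show thesis using that by (elim bexE)
qed

lemma shatters_mono:
  assumes "shatters F B" "F \<subseteq> G"
  shows "shatters G B"
  unfolding shatters_def
proof (intro allI impI)
  fix C assume "C \<subseteq> B"
  with assms(1) obtain A where "A \<in> F" "A \<inter> B = C" by (rule shattersE)
  then show "\<exists>A\<in>G. A \<inter> B = C" using assms(2) by (intro bexI[of _ A]) auto
qed

text \<open>Pajor's strengthening of the Sauer--Shelah lemma.\<close>

lemma card_le_card_shattered:
  assumes "finite S" "F \<subseteq> Pow S"
  shows "card F \<le> card {B. B \<subseteq> S \<and> shatters F B}"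
  using assms
proof (induction S arbitrary: F rule: finite_induct)
  case empty
  then consider "F = {}" | "F = {{}}" by (auto simp: subset_singleton_iff)
  then show ?case
  proof cases
    case 2
    then have "{B. B \<subseteq> {} \<and> shatters F B} = {{}}" by (auto simp: shatters_def)
    then show ?thesis using 2 by simp
  qed simp
next
  case (insert a S)
  define F0 where "F0 = {A\<in>F. a \<notin> A}"
  define F1 where "F1 = (\<lambda>A. A - {a}) ` {A\<in>F. a \<in> A}"
  define Sh where "Sh G = {B. B \<subseteq> S \<and> shatters G B}" for G
  have finF: "finite F"
    using insert by (meson finite.insertI finite_Pow_iff finite_subset)
  have finSh: "finite (Sh G)" for G
    unfolding Sh_def using insert by auto
  have sub: "F0 \<subseteq> Pow S" "F1 \<subseteq> Pow S"
    using insert.prems by (auto simp: F0_def F1_def)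
  have inj: "inj_on (\<lambda>A. A - {a}) {A\<in>F. a \<in> A}"
    by (auto simp: inj_on_def)
  have "card F = card (F0 \<union> {A\<in>F. a \<in> A})"
    by (rule arg_cong[where f=card]) (auto simp: F0_def)
  also have "\<dots> = card F0 + card {A\<in>F. a \<in> A}"
    using finF by (intro card_Un_disjoint) (auto simp: F0_def)
  also have "card {A\<in>F. a \<in> A} = card F1"
    using inj by (simp add: F1_def card_image)
  finally have "card F = card F0 + card F1" .
  moreover have "card F0 + card F1 \<le> card (Sh F0) + card (Sh F1)"
    using insert.IH[OF sub(1)] insert.IH[OF sub(2)] unfolding Sh_def by linarith
  \<comment> \<open>A set \<open>B\<close> shattered by both halves is counted twice. The second
    count is charged to \<open>insert a B\<close>: \<open>F\<close> shatters it, since each trace on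
    \<open>B\<close> comes both from a member with \<open>a\<close> and from one without.\<close>
  moreover have "card (Sh F0) + card (Sh F1) = card (Sh F0 \<union> Sh F1) + card (Sh F0 \<inter> Sh F1)"
    by (rule card_Un_Int) (auto intro: finSh)
  moreover have "card (Sh F0 \<inter> Sh F1) = card (insert a ` (Sh F0 \<inter> Sh F1))"
    using insert.hyps by (intro card_image[symmetric]) (auto simp: inj_on_def Sh_def)
  moreover have "card (Sh F0 \<union> Sh F1) + card (insert a ` (Sh F0 \<inter> Sh F1))
      = card ((Sh F0 \<union> Sh F1) \<union> insert a ` (Sh F0 \<inter> Sh F1))"
    using insert.hyps by (intro card_Un_disjoint[symmetric]) (auto intro: finSh simp: Sh_def)
  moreover have "card ((Sh F0 \<union> Sh F1) \<union> insert a ` (Sh F0 \<inter> Sh F1))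
      \<le> card {B. B \<subseteq> insert a S \<and> shatters F B}"
  proof (rule card_mono)
    show "finite {B. B \<subseteq> insert a S \<and> shatters F B}" using insert.hyps by auto
    have sh0: "shatters F B" if "B \<in> Sh F0" for B
      using that by (intro shatters_mono[of F0 B F]) (auto simp: Sh_def F0_def)
    have sh1: "shatters F B" if "B \<in> Sh F1" for B
      unfolding shatters_def
    proof (intro allI impI)
      have B: "B \<subseteq> S" "shatters F1 B" using that by (simp_all add: Sh_def)
      fix C assume "C \<subseteq> B"
      with B(2) obtain A where A: "A \<in> F1" "A \<inter> B = C" by (rule shattersE)
      then obtain A' where "A' \<in> F" "A = A' - {a}" by (auto simp: F1_def)
      moreover have "a \<notin> B" using B(1) insert.hyps by auto
      ultimately show "\<exists>A\<in>F. A \<inter> B = C" using A(2) by (intro bexI[of _ A']) auto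
    qed
    have sh2: "shatters F (insert a B)" if "B \<in> Sh F0" "B \<in> Sh F1" for B
      unfolding shatters_def
    proof (intro allI impI)
      have B: "B \<subseteq> S" "shatters F0 B" "shatters F1 B" using that by (simp_all add: Sh_def)
      fix C assume C: "C \<subseteq> insert a B"
      have aB: "a \<notin> B" using B(1) insert.hyps by auto
      show "\<exists>A\<in>F. A \<inter> insert a B = C"
      proof (cases "a \<in> C")
        case True
        have "C - {a} \<subseteq> B" using C by auto
        with B(3) obtain A where A: "A \<in> F1" "A \<inter> B = C - {a}" by (rule shattersE)
        then obtain A' where "A' \<in> F" "A = A' - {a}" "a \<in> A'" by (auto simp: F1_def)
        then show ?thesis using A(2) aB True by (intro bexI[of _ A']) auto
      next
        case False
        then have "C \<subseteq> B" using C by auto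
        with B(2) obtain A where A: "A \<in> F0" "A \<inter> B = C" by (rule shattersE)
        then show ?thesis by (intro bexI[of _ A]) (auto simp: F0_def)
      qed
    qed
    show "(Sh F0 \<union> Sh F1) \<union> insert a ` (Sh F0 \<inter> Sh F1) \<subseteq> {B. B \<subseteq> insert a S \<and> shatters F B}"
    proof
      fix B assume "B \<in> (Sh F0 \<union> Sh F1) \<union> insert a ` (Sh F0 \<inter> Sh F1)"
      then consider "B \<in> Sh F0" | "B \<in> Sh F1"
        | B' where "B = insert a B'" "B' \<in> Sh F0" "B' \<in> Sh F1" by blast
      then show "B \<in> {B. B \<subseteq> insert a S \<and> shatters F B}"
      proof cases
        case 1
        with sh0 show ?thesis by (simp add: Sh_def subset_insertI2)
      next
        case 2
        with sh1 show ?thesis by (simp add: Sh_def subset_insertI2)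
      next
        case (3 B')
        with sh2[OF 3(2,3)] show ?thesis by (simp add: Sh_def subset_insertI2 insert_mono)
      qed
    qed
  qed
  ultimately show ?case by linarith
qed

lemma sum_power_card_Pow:
  fixes x :: real
  assumes "finite S"
  shows "(\<Sum>B\<in>Pow S. x ^ card B) = (1 + x) ^ card S"
  using assms
proof (induction S rule: finite_induct)
  case (insert a S)
  have "(\<Sum>B\<in>Pow (insert a S). x ^ card B)
      = (\<Sum>B\<in>Pow S. x ^ card B) + (\<Sum>B\<in>insert a ` Pow S. x ^ card B)"
    unfolding Pow_insert using insert.hyps by (intro sum.union_disjoint) auto
  also have "(\<Sum>B\<in>insert a ` Pow S. x ^ card B) = (\<Sum>B\<in>Pow S. x ^ card (insert a B))"
    using insert.hyps by (subst sum.reindex) (auto simp: inj_on_def)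
  also have "\<dots> = (\<Sum>B\<in>Pow S. x * x ^ card B)"
  proof (rule sum.cong)
    fix B assume "B \<in> Pow S"
    then have "a \<notin> B" "finite B" using insert.hyps finite_subset by auto
    then show "x ^ card (insert a B) = x * x ^ card B" by simp
  qed simp
  finally show ?case
    using insert by (simp add: sum_distrib_left[symmetric] algebra_simps)
qed simp

text \<open>The free parameter \<open>x\<close> replaces the usual bound \<open>(e k / D) ^ D\<close>.\<close>

lemma card_shattered_le_exp:
  fixes x :: real
  assumes S: "finite S" "card S \<le> k" and F: "F \<subseteq> Pow S"
    and D: "\<And>B. B \<subseteq> S \<Longrightarrow> shatters F B \<Longrightarrow> card B \<le> D"
    and x: "0 < x" "x \<le> 1"
  shows "real (card F) * x ^ D \<le> exp (x * real k)"
proof -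
  have "card F \<le> card {B. B \<subseteq> S \<and> card B \<le> D}"
    using S F D by (intro order.trans[OF card_le_card_shattered[OF S(1) F]] card_mono) auto
  then have "real (card F) * x ^ D \<le> (\<Sum>B\<in>{B. B \<subseteq> S \<and> card B \<le> D}. x ^ D)"
    using x by simp
  also have "\<dots> \<le> (\<Sum>B\<in>{B. B \<subseteq> S \<and> card B \<le> D}. x ^ card B)"
    using x by (intro sum_mono power_decreasing) auto
  also have "\<dots> \<le> (\<Sum>B\<in>Pow S. x ^ card B)"
    using S x by (intro sum_mono2) auto
  also have "\<dots> = (1 + x) ^ card S" by (rule sum_power_card_Pow[OF S(1)])
  also have "\<dots> \<le> exp x ^ card S"
    using x by (intro power_mono) auto
  also have "\<dots> \<le> exp x ^ k"
    using x S by (intro power_increasing) auto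
  also have "\<dots> = exp (x * real k)"
    by (simp add: exp_of_nat2_mult)
  finally show ?thesis .
qed

text \<open>Dudley's argument: a few random indices already tell all pairs of separated sets apart.\<close>

lemma separating_indices:
  fixes e :: real
  assumes I: "finite I" and U: "finite U" "U \<subseteq> Pow I" "U \<noteq> {}"
    and sep: "\<And>A B. A \<in> U \<Longrightarrow> B \<in> U \<Longrightarrow> A \<noteq> B \<Longrightarrow> e * card I \<le> card (sym_diff A B)"
    and k: "2 * ln (card U) \<le> e * real k"
  shows "\<exists>S\<subseteq>I. card S \<le> k \<and> inj_on (\<lambda>A. A \<inter> S) U"
proof (cases "card I = 0")
  case True
  then have "I = {}" using I by simp
  then show ?thesis using U by (intro exI[of _ "{}"]) (auto simp: inj_on_def)
next
  case False
  define n where "n = card I"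
  define m where "m = card U"
  have n: "n > 0" using False by (simp add: n_def)
  have m: "m > 0" using U by (simp add: m_def card_gt_0_iff)
  \<comment> \<open>The indices are drawn with replacement: an outcome is a function on
    \<open>{..<k}\<close>, and probabilities become counts of functions.\<close>
  define G where "G = {..<k} \<rightarrow>\<^sub>E I"
  define bad where "bad A B = {..<k} \<rightarrow>\<^sub>E (I - sym_diff A B)" for A B :: "'a set"
  define pairs where "pairs = {(A, B) \<in> U \<times> U. A \<noteq> B}"
  have finpairs: "finite pairs" unfolding pairs_def using U by (auto intro: finite_subset[of _ "U \<times> U"])
  \<comment> \<open>One index misses the symmetric difference with frequency at most
    \<open>1 - e \<le> exp (- e)\<close>. The condition on \<open>k\<close> makes the
    \<open>k\<close>-th power at most \<open>1 / m ^ 2\<close>, which suits a union bound over fewer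
    than \<open>m ^ 2\<close> pairs.\<close>
  have bad_le: "real (card (bad A B)) \<le> real n ^ k / real m ^ 2" if "(A, B) \<in> pairs" for A B
  proof -
    have AB: "A \<in> U" "B \<in> U" "A \<noteq> B" using that by (auto simp: pairs_def)
    have sI: "sym_diff A B \<subseteq> I" using AB U by auto
    have c: "card (I - sym_diff A B) = n - card (sym_diff A B)"
      unfolding n_def using sI I by (intro card_Diff_subset) (rule finite_subset)
    have le: "card (sym_diff A B) \<le> n" unfolding n_def using sI I by (rule card_mono[rotated])
    have "real (card (I - sym_diff A B)) \<le> real n * (1 - e)"
      using sep[OF AB] c le by (simp add: n_def algebra_simps)
    also have "\<dots> \<le> real n * exp (- e)"
      using exp_ge_add_one_self[of "-e"] by (intro mult_left_mono) auto
    finally have 1: "real (card (I - sym_diff A B)) \<le> real n * exp (- e)" .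
    have "real (card (bad A B)) = real (card (I - sym_diff A B)) ^ k"
      by (simp add: bad_def card_PiE)
    also have "\<dots> \<le> (real n * exp (- e)) ^ k"
      by (intro power_mono 1) auto
    also have "\<dots> = real n ^ k * exp (- (e * k))"
      by (simp add: power_mult_distrib exp_of_nat2_mult[symmetric])
    also have "\<dots> \<le> real n ^ k * exp (- (2 * ln m))"
      using k by (intro mult_left_mono) (auto simp: m_def)
    also have "exp (- (2 * ln m)) = 1 / real m ^ 2"
      using m by (simp add: exp_minus exp_double field_simps)
    finally show ?thesis by simp
  qed
  have "card (\<Union>(A, B)\<in>pairs. bad A B) < card G"
  proof -
    have "real (card (\<Union>(A, B)\<in>pairs. bad A B)) \<le> real (\<Sum>p\<in>pairs. card (case p of (A, B) \<Rightarrow> bad A B))"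
      using finpairs by (intro of_nat_mono card_UN_le)
    also have "\<dots> = (\<Sum>(A, B)\<in>pairs. real (card (bad A B)))"
      by (simp add: case_prod_unfold)
    also have "\<dots> \<le> (\<Sum>p\<in>pairs. real n ^ k / real m ^ 2)"
      using bad_le by (intro sum_mono) auto
    also have "\<dots> = real (card pairs) * (real n ^ k / real m ^ 2)" by simp
    \<comment> \<open>Strict, because \<open>U\<close> is nonempty and the diagonal of
      \<open>U \<times> U\<close> contributes no pair.\<close>
    also have "\<dots> < real m ^ 2 * (real n ^ k / real m ^ 2)"
    proof (rule mult_strict_right_mono)
      obtain A where "A \<in> U" using U by auto
      then have "pairs \<subset> U \<times> U" by (auto simp: pairs_def)
      then have "card pairs < card (U \<times> U)" using U by (intro psubset_card_mono) auto
      then show "real (card pairs) < real m ^ 2"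
        by (simp add: card_cartesian_product m_def power2_eq_square flip: of_nat_mult)
    qed (use n m in auto)
    also have "\<dots> = real (card G)"
      using m by (simp add: G_def card_PiE n_def)
    finally show ?thesis by simp
  qed
  moreover have "(\<Union>(A, B)\<in>pairs. bad A B) \<subseteq> G" unfolding bad_def G_def by (auto simp: PiE_iff)
  ultimately have "(\<Union>(A, B)\<in>pairs. bad A B) \<subset> G" by force
  then obtain g where g: "g \<in> G" "g \<notin> (\<Union>(A, B)\<in>pairs. bad A B)" by blast
  have "inj_on (\<lambda>A. A \<inter> g ` {..<k}) U"
  proof (rule inj_onI, rule ccontr)
    fix A B assume AB: "A \<in> U" "B \<in> U" "A \<inter> g ` {..<k} = B \<inter> g ` {..<k}" "A \<noteq> B"
    then have "(A, B) \<in> pairs" by (auto simp: pairs_def)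
    then have "g \<notin> bad A B" using g by auto
    then obtain i where "i < k" "g i \<in> sym_diff A B"
      using g(1) by (auto simp: bad_def G_def PiE_iff)
    then show False using AB(3) by auto
  qed
  moreover have "g ` {..<k} \<subseteq> I" using g by (auto simp: G_def)
  moreover have "card (g ` {..<k}) \<le> k" using card_image_le[of "{..<k}" g] by simp
  ultimately show ?thesis by (intro exI[of _ "g ` {..<k}"] conjI)
qed

text \<open>Sauer--Shelah is applied to the traces on about \<open>2 * ln m / e\<close> indices, so
  \<open>ln m\<close> for the size \<open>m\<close> of \<open>U\<close> occurs on both sides. The
  parameter \<open>x = e / 4\<close> gives it the coefficient \<open>1 / 2\<close> on the right,
  which the left side absorbs; the final \<open>1 / 2\<close> pays for rounding up the number of
  indices.\<close>

lemma ln_card_separated_le: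
  fixes e :: real
  assumes I: "finite I" and U: "finite U" "U \<subseteq> Pow I" "U \<noteq> {}" and e: "0 < e" "e \<le> 1"
    and sep: "\<And>A B. A \<in> U \<Longrightarrow> B \<in> U \<Longrightarrow> A \<noteq> B \<Longrightarrow> e * card I \<le> card (sym_diff A B)"
    and D: "\<And>B. B \<subseteq> I \<Longrightarrow> shatters U B \<Longrightarrow> card B \<le> D"
  shows "ln (card U) \<le> 2 * real D * ln (4 / e) + 1 / 2"
proof -
  define m where "m = card U"
  have m: "m > 0" using U by (simp add: m_def card_gt_0_iff)
  define k where "k = nat \<lceil>2 * ln m / e\<rceil>"
  have k0: "0 \<le> 2 * ln m / e" using m e by simp
  have k1: "2 * ln m / e \<le> real k" "real k \<le> 2 * ln m / e + 1"
    unfolding k_def using k0 by linarith+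
  have "2 * ln (card U) \<le> e * real k"
    using k1(1) e by (simp add: field_simps m_def)
  from separating_indices[OF I U sep this]
  obtain S where S: "S \<subseteq> I" "card S \<le> k" "inj_on (\<lambda>A. A \<inter> S) U" by blast
  define F where "F = (\<lambda>A. A \<inter> S) ` U"
  have "real (card F) * (e / 4) ^ D \<le> exp (e / 4 * real k)"
  proof (rule card_shattered_le_exp)
    show "finite S" using S I finite_subset by blast
    show "card B \<le> D" if B: "B \<subseteq> S" "shatters F B" for B
    proof (rule D)
      show "B \<subseteq> I" using B S by auto
      show "shatters U B" unfolding shatters_def
      proof (intro allI impI)
        fix C assume "C \<subseteq> B"
        with B(2) obtain A' where "A' \<in> F" "A' \<inter> B = C" by (rule shattersE)
        then obtain A where "A \<in> U" "(A \<inter> S) \<inter> B = C" unfolding F_def by blast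
        then show "\<exists>A\<in>U. A \<inter> B = C" using B(1) by (intro bexI[of _ A]) auto
      qed
    qed
  qed (use S e in \<open>auto simp: F_def\<close>)
  also have "card F = m" unfolding F_def m_def using S(3) by (rule card_image)
  finally have "ln (real m * (e / 4) ^ D) \<le> e / 4 * real k"
    using m e by (subst (asm) ln_le_cancel_iff[symmetric]) auto
  then have "ln m + real D * ln (e / 4) \<le> e / 4 * real k"
    using m e by (simp add: ln_mult ln_realpow)
  also have "\<dots> \<le> e / 4 * (2 * ln m / e + 1)"
    using k1 e by (intro mult_left_mono) auto
  also have "\<dots> = ln m / 2 + e / 4" using e by (simp add: field_simps)
  finally show ?thesis
    using e by (simp add: m_def ln_div algebra_simps)
qed

section \<open>Rademacher averages and chaining\<close>

text \<open>Extensional functions make this a finite set. A Rademacher average is then a finite sum,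
  left unnormalized with the factor \<open>2 ^ card I\<close> on the other side, and the signs
  require no probability space.\<close>

abbreviation signs :: "'i set \<Rightarrow> ('i \<Rightarrow> real) set" where
  "signs I \<equiv> I \<rightarrow>\<^sub>E {-1, 1}"

lemma card_signs: "finite I \<Longrightarrow> card (signs I) = 2 ^ card I"
  by (simp add: card_PiE numeral_2_eq_2)

lemma exp_add_exp_minus_le:
  fixes x :: real
  shows "exp x + exp (- x) \<le> 2 * exp (x\<^sup>2 / 2)"
proof -
  have *: "exp x + exp (- x) \<le> 2 * exp (x\<^sup>2 / 2)" if "x \<ge> 0" for x :: real
  proof -
    have pos: "1 + 1 / 2 * (exp (2 * x) - 1) > 0"
      using exp_gt_zero[of "2 * x"] by argo
    \<comment> \<open>The case \<open>p = 1 / 2\<close> of Hoeffding's lemma is the bound \<open>ln (cosh x) \<le> x\<^sup>2 / 2\<close>.\<close>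
    have "- (2 * x) * (1 / 2) + ln (1 + 1 / 2 * (exp (2 * x) - 1)) \<le> (2 * x)\<^sup>2 / 8"
      using that by (intro Hoeffdings_lemma_aux) auto
    then have "exp (- x + ln (1 + 1 / 2 * (exp (2 * x) - 1))) \<le> exp (x\<^sup>2 / 2)"
      by (simp add: power2_eq_square)
    then have "exp (- x) * (1 + 1 / 2 * (exp (2 * x) - 1)) \<le> exp (x\<^sup>2 / 2)"
      using pos by (simp only: exp_add exp_ln)
    moreover have "exp (- x) * exp (2 * x) = exp x"
      by (simp flip: exp_add)
    ultimately show ?thesis by (simp add: algebra_simps)
  qed
  show ?thesis using *[of x] *[of "- x"] by (cases "x \<ge> 0") auto
qed

text \<open>Independence of the signs becomes the factorization of a sum over \<open>signs I\<close>
  into a product over coordinates; each factor is \<open>2 * cosh (l * a i)\<close>. This is the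
  subgaussian bound for a weighted sign sum, valid for either sign of \<open>l\<close>.\<close>

lemma sum_signs_exp_le:
  fixes a :: "'i \<Rightarrow> real"
  assumes "finite I"
  shows "(\<Sum>\<epsilon>\<in>signs I. exp (l * (\<Sum>i\<in>I. \<epsilon> i * a i))) \<le> 2 ^ card I * exp (l\<^sup>2 * (\<Sum>i\<in>I. (a i)\<^sup>2) / 2)"
proof -
  have "(\<Sum>\<epsilon>\<in>signs I. exp (l * (\<Sum>i\<in>I. \<epsilon> i * a i))) = (\<Sum>\<epsilon>\<in>signs I. \<Prod>i\<in>I. exp (l * (\<epsilon> i * a i)))"
    using assms by (simp add: sum_distrib_left exp_sum)
  also have "\<dots> = (\<Prod>i\<in>I. \<Sum>e\<in>{-1, 1}. exp (l * (e * a i)))"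
    using assms by (subst prod_sum_PiE) auto
  also have "\<dots> \<le> (\<Prod>i\<in>I. 2 * exp ((l * a i)\<^sup>2 / 2))"
    using exp_add_exp_minus_le by (intro prod_mono) (auto simp: add.commute add_nonneg_nonneg)
  also have "\<dots> = 2 ^ card I * exp (\<Sum>i\<in>I. (l * a i)\<^sup>2 / 2)"
    using assms by (simp add: prod.distrib exp_sum)
  also have "(\<Sum>i\<in>I. (l * a i)\<^sup>2 / 2) = l\<^sup>2 * (\<Sum>i\<in>I. (a i)\<^sup>2) / 2"
    by (simp add: power_mult_distrib sum_distrib_left sum_divide_distrib)
  finally show ?thesis .
qed

text \<open>Massart's finite class lemma, with the exponential parameter \<open>l\<close> left free.\<close>

lemma sum_signs_Max_le:
  fixes a :: "'t \<Rightarrow> 'i \<Rightarrow> real"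
  assumes I: "finite I" and T: "finite T" "T \<noteq> {}"
    and r: "\<And>t. t \<in> T \<Longrightarrow> (\<Sum>i\<in>I. (a t i)\<^sup>2) \<le> r" and l: "l > 0"
  shows "(\<Sum>\<epsilon>\<in>signs I. MAX t\<in>T. \<bar>\<Sum>i\<in>I. \<epsilon> i * a t i\<bar>)
    \<le> 2 ^ card I * (ln (2 * card T) / l + l * r / 2)"
proof -
  define S where "S \<epsilon> t = (\<Sum>i\<in>I. \<epsilon> i * a t i)" for \<epsilon> t
  define X where "X \<epsilon> = (MAX t\<in>T. \<bar>S \<epsilon> t\<bar>)" for \<epsilon>
  define K where "K = 2 * real (card T) * exp (l\<^sup>2 * r / 2)"
  have cT: "card T > 0" using T by (simp add: card_gt_0_iff)
  then have K: "K > 0" by (simp add: K_def)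
  have lnK: "ln K = ln (2 * card T) + l\<^sup>2 * r / 2"
    using cT by (simp add: K_def ln_mult)
  \<comment> \<open>The maximum is attained at some \<open>t\<close>, and both signs of the exponent
    together dominate the absolute value; hence the factor 2 in \<open>K\<close> and in
    \<open>ln (2 * card T)\<close>.\<close>
  have expX: "exp (l * X \<epsilon>) \<le> (\<Sum>t\<in>T. exp (l * S \<epsilon> t) + exp ((- l) * S \<epsilon> t))" for \<epsilon>
  proof -
    have "X \<epsilon> \<in> (\<lambda>t. \<bar>S \<epsilon> t\<bar>) ` T" unfolding X_def using T by (intro Max_in) auto
    then obtain t where t: "t \<in> T" "X \<epsilon> = \<bar>S \<epsilon> t\<bar>" by auto
    have "exp (l * X \<epsilon>) \<le> exp (l * S \<epsilon> t) + exp ((- l) * S \<epsilon> t)"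
      unfolding t(2) by (cases "S \<epsilon> t \<ge> 0") (auto simp: less_imp_le)
    also have "\<dots> \<le> (\<Sum>t\<in>T. exp (l * S \<epsilon> t) + exp ((- l) * S \<epsilon> t))"
      using T t(1) by (intro member_le_sum) (auto intro!: add_nonneg_nonneg)
    finally show ?thesis .
  qed
  have mgf: "(\<Sum>\<epsilon>\<in>signs I. exp (l' * S \<epsilon> t)) \<le> 2 ^ card I * exp (l\<^sup>2 * r / 2)"
    if "t \<in> T" "l'\<^sup>2 = l\<^sup>2" for t l'
  proof -
    have "(\<Sum>\<epsilon>\<in>signs I. exp (l' * S \<epsilon> t)) \<le> 2 ^ card I * exp (l'\<^sup>2 * (\<Sum>i\<in>I. (a t i)\<^sup>2) / 2)"
      unfolding S_def by (rule sum_signs_exp_le[OF I])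
    also have "\<dots> \<le> 2 ^ card I * exp (l\<^sup>2 * r / 2)"
      using r[OF that(1)] that(2) by (simp add: mult_left_mono)
    finally show ?thesis .
  qed
  have "(\<Sum>\<epsilon>\<in>signs I. exp (l * X \<epsilon>)) \<le> (\<Sum>\<epsilon>\<in>signs I. \<Sum>t\<in>T. exp (l * S \<epsilon> t) + exp ((- l) * S \<epsilon> t))"
    by (intro sum_mono expX)
  also have "\<dots> = (\<Sum>t\<in>T. (\<Sum>\<epsilon>\<in>signs I. exp (l * S \<epsilon> t)) + (\<Sum>\<epsilon>\<in>signs I. exp ((- l) * S \<epsilon> t)))"
    by (subst sum.swap) (simp add: sum.distrib)
  also have "\<dots> \<le> (\<Sum>t\<in>T. 2 ^ card I * exp (l\<^sup>2 * r / 2) + 2 ^ card I * exp (l\<^sup>2 * r / 2))"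
    by (intro sum_mono add_mono mgf) auto
  also have "\<dots> = 2 ^ card I * K" by (simp add: K_def)
  finally have sum_exp: "(\<Sum>\<epsilon>\<in>signs I. exp (l * X \<epsilon>)) \<le> 2 ^ card I * K" .
  \<comment> \<open>This is \<open>1 + u \<le> exp u\<close> at
    \<open>u = l * X \<epsilon> - ln K\<close>. Averaged over the signs, it has the effect of
    Jensen's inequality for the logarithm, since the average of
    \<open>exp (l * X \<epsilon>)\<close> is at most \<open>K\<close>.\<close>
  have "l * X \<epsilon> \<le> ln K + exp (l * X \<epsilon>) / K - 1" for \<epsilon>
    using exp_ge_add_one_self[of "l * X \<epsilon> - ln K"] K by (simp add: exp_diff)
  then have "(\<Sum>\<epsilon>\<in>signs I. l * X \<epsilon>) \<le> (\<Sum>\<epsilon>\<in>signs I. (ln K - 1) + exp (l * X \<epsilon>) / K)"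
    by (intro sum_mono) (simp add: algebra_simps)
  also have "\<dots> = 2 ^ card I * (ln K - 1) + (\<Sum>\<epsilon>\<in>signs I. exp (l * X \<epsilon>)) / K"
    using I by (simp add: sum.distrib card_signs sum_divide_distrib)
  also have "\<dots> \<le> 2 ^ card I * (ln K - 1) + 2 ^ card I * K / K"
    using K by (intro add_left_mono divide_right_mono sum_exp) auto
  also have "\<dots> = 2 ^ card I * ln K" using K by (simp add: algebra_simps)
  finally have "l * (\<Sum>\<epsilon>\<in>signs I. X \<epsilon>) \<le> 2 ^ card I * ln K"
    by (simp add: sum_distrib_left)
  then have "(\<Sum>\<epsilon>\<in>signs I. X \<epsilon>) \<le> 2 ^ card I * ln K / l"
    using l by (simp add: field_simps)
  also have "\<dots> = 2 ^ card I * (ln (2 * card T) / l + l * r / 2)"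
    using l unfolding lnK by (simp add: field_simps power2_eq_square)
  finally show ?thesis by (simp add: X_def S_def)
qed

text \<open>The one-set case of the finite class bound, with \<open>l = 1 / sqrt (card I)\<close>.
  It serves twice: at the coarsest level of the chain and for the imbalance of the signs.\<close>

lemma sum_signs_abs_le:
  assumes I: "finite I" "A \<subseteq> I" "card I \<ge> 1"
  shows "(\<Sum>\<epsilon>\<in>signs I. \<bar>\<Sum>i\<in>A. \<epsilon> i\<bar>) \<le> 2 ^ card I * (2 * sqrt (card I))"
proof -
  define n where "n = real (card I)"
  have n: "n \<ge> 1" using I by (simp add: n_def)
  have "(\<Sum>i\<in>I. \<epsilon> i * of_bool (i \<in> A)) = (\<Sum>i\<in>A. \<epsilon> i)" for \<epsilon> :: "'a \<Rightarrow> real"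
    using I by (simp add: sum.If_cases Int_absorb1 of_bool_def if_distrib cong: if_cong)
  moreover have "(\<Sum>\<epsilon>\<in>signs I. MAX t\<in>{A}. \<bar>\<Sum>i\<in>I. \<epsilon> i * of_bool (i \<in> t)\<bar>)
      \<le> 2 ^ card I * (ln (2 * card {A}) / (1 / sqrt n) + 1 / sqrt n * n / 2)"
  proof (rule sum_signs_Max_le)
    have "(\<Sum>i\<in>I. (of_bool (i \<in> A))\<^sup>2) \<le> (\<Sum>i\<in>I. 1::real)" by (intro sum_mono) auto
    then show "(\<Sum>i\<in>I. (of_bool (i \<in> t))\<^sup>2) \<le> n" if "t \<in> {A}" for t
      using that by (simp add: n_def)
  qed (use I n in auto)
  ultimately have "(\<Sum>\<epsilon>\<in>signs I. \<bar>\<Sum>i\<in>A. \<epsilon> i\<bar>) \<le> 2 ^ card I * (ln 2 * sqrt n + n / sqrt n / 2)"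
    by simp
  also have "n / sqrt n = sqrt n" using n by (simp add: real_div_sqrt)
  also have "2 ^ card I * (ln 2 * sqrt n + sqrt n / 2) \<le> 2 ^ card I * (2 * sqrt n)"
  proof (rule mult_left_mono)
    have "ln 2 * sqrt n \<le> 1 * sqrt n"
      using ln_le_minus_one[of 2] n by (intro mult_right_mono) auto
    then show "ln 2 * sqrt n + sqrt n / 2 \<le> 2 * sqrt n" using n real_sqrt_ge_zero[of n] by linarith
  qed simp
  finally show ?thesis by (simp add: n_def)
qed

section \<open>Nets of set systems and chaining\<close>

lemma exists_separated_net:
  fixes d :: real
  assumes "finite F" "d \<ge> 0"
  shows "\<exists>T\<subseteq>F. (\<forall>A\<in>T. \<forall>B\<in>T. A \<noteq> B \<longrightarrow> d < card (sym_diff A B)) \<and>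
    (\<forall>A\<in>F. \<exists>B\<in>T. card (sym_diff A B) \<le> d)"
  using assms(1)
proof (induction F rule: finite_induct)
  case (insert A F)
  then obtain T where T: "T \<subseteq> F" "\<forall>A\<in>T. \<forall>B\<in>T. A \<noteq> B \<longrightarrow> d < card (sym_diff A B)"
    "\<forall>A\<in>F. \<exists>B\<in>T. card (sym_diff A B) \<le> d" by auto
  \<comment> \<open>The choice is greedy: \<open>A\<close> joins \<open>T\<close> exactly when no
    member is within distance \<open>d\<close>. This keeps \<open>T\<close> separated, and a set
    that is left out is covered by the member that excluded it.\<close>
  show ?case
  proof (cases "\<exists>B\<in>T. card (sym_diff A B) \<le> d")
    case True
    then show ?thesis using T by (intro exI[of _ T]) auto
  next
    case False
    then have "\<forall>B\<in>T. d < card (sym_diff A B)" by auto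
    moreover have "card (sym_diff B A) = card (sym_diff A B)" for B
      by (simp add: Un_commute)
    moreover have "card (sym_diff A A) \<le> d" using assms(2) by simp
    ultimately show ?thesis
      using T by (intro exI[of _ "insert A T"] conjI) (auto simp del: Diff_cancel)
  qed
qed simp

text \<open>A link replaces each \<open>A\<close> of the finer family by a nearby \<open>p A\<close>
  of the coarser one. There is one link for each \<open>A\<close>, with coordinates in
  \<open>{-1, 0, 1}\<close>, so its squared length is the size of a symmetric difference, at most
  \<open>d\<close>; the finite class bound controls the maximum over all links.\<close>

lemma chaining_step:
  fixes T T' :: "'i set set" and d :: real
  assumes I: "finite I" and T: "finite T" "T \<subseteq> Pow I" and T': "finite T'" "T' \<noteq> {}" "T' \<subseteq> Pow I"
    and net: "\<And>A. A \<in> T' \<Longrightarrow> \<exists>B\<in>T. card (sym_diff A B) \<le> d" and l: "l > 0"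
  shows "(\<Sum>\<epsilon>\<in>signs I. MAX A\<in>T'. \<bar>\<Sum>i\<in>A. \<epsilon> i\<bar>)
    \<le> (\<Sum>\<epsilon>\<in>signs I. MAX A\<in>T. \<bar>\<Sum>i\<in>A. \<epsilon> i\<bar>) + 2 ^ card I * (ln (2 * card T') / l + l * d / 2)"
proof -
  obtain p where p: "\<And>A. A \<in> T' \<Longrightarrow> p A \<in> T" "\<And>A. A \<in> T' \<Longrightarrow> card (sym_diff A (p A)) \<le> d"
    using net by metis
  define a where "a A i = (of_bool (i \<in> A) - of_bool (i \<in> p A) :: real)" for A i
  have bool_sum: "(\<Sum>i\<in>I. \<epsilon> i * of_bool (i \<in> A)) = (\<Sum>i\<in>A. \<epsilon> i)" if "A \<subseteq> I"
    for A and \<epsilon> :: "'i \<Rightarrow> real"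
    using that I by (simp add: sum.If_cases Int_absorb1 of_bool_def if_distrib cong: if_cong)
  have link: "(\<Sum>i\<in>A. \<epsilon> i) = (\<Sum>i\<in>p A. \<epsilon> i) + (\<Sum>i\<in>I. \<epsilon> i * a A i)" if "A \<in> T'"
    for A and \<epsilon> :: "'i \<Rightarrow> real"
  proof -
    have "A \<subseteq> I" "p A \<subseteq> I" using that p(1) T T' by auto
    then show ?thesis
      by (simp add: a_def right_diff_distrib sum_subtractf bool_sum)
  qed
  have "(MAX A\<in>T'. \<bar>\<Sum>i\<in>A. \<epsilon> i\<bar>) \<le>
      (MAX A\<in>T. \<bar>\<Sum>i\<in>A. \<epsilon> i\<bar>) + (MAX A\<in>T'. \<bar>\<Sum>i\<in>I. \<epsilon> i * a A i\<bar>)" for \<epsilon> :: "'i \<Rightarrow> real"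
  proof (rule Max.boundedI)
    fix x assume "x \<in> (\<lambda>A. \<bar>\<Sum>i\<in>A. \<epsilon> i\<bar>) ` T'"
    then obtain A where A: "A \<in> T'" "x = \<bar>\<Sum>i\<in>A. \<epsilon> i\<bar>" by auto
    have "x \<le> \<bar>\<Sum>i\<in>p A. \<epsilon> i\<bar> + \<bar>\<Sum>i\<in>I. \<epsilon> i * a A i\<bar>"
      unfolding A(2) link[OF A(1)] by (rule abs_triangle_ineq)
    also have "\<dots> \<le> (MAX A\<in>T. \<bar>\<Sum>i\<in>A. \<epsilon> i\<bar>) + (MAX A\<in>T'. \<bar>\<Sum>i\<in>I. \<epsilon> i * a A i\<bar>)"
      using A p(1) T T' by (intro add_mono Max_ge) auto
    finally show "x \<le> (MAX A\<in>T. \<bar>\<Sum>i\<in>A. \<epsilon> i\<bar>) + (MAX A\<in>T'. \<bar>\<Sum>i\<in>I. \<epsilon> i * a A i\<bar>)" .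
  qed (use T' in auto)
  then have "(\<Sum>\<epsilon>\<in>signs I. MAX A\<in>T'. \<bar>\<Sum>i\<in>A. \<epsilon> i\<bar>)
    \<le> (\<Sum>\<epsilon>\<in>signs I. MAX A\<in>T. \<bar>\<Sum>i\<in>A. \<epsilon> i\<bar>) + (\<Sum>\<epsilon>\<in>signs I. MAX A\<in>T'. \<bar>\<Sum>i\<in>I. \<epsilon> i * a A i\<bar>)"
    unfolding sum.distrib[symmetric] by (intro sum_mono)
  moreover have "(\<Sum>\<epsilon>\<in>signs I. MAX A\<in>T'. \<bar>\<Sum>i\<in>I. \<epsilon> i * a A i\<bar>)
      \<le> 2 ^ card I * (ln (2 * card T') / l + l * d / 2)"
  proof (rule sum_signs_Max_le[OF I T'(1,2) _ l])
    fix A assume A: "A \<in> T'"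
    have sub: "sym_diff A (p A) \<subseteq> I" using A p(1) T T' by auto
    have "(a A i)\<^sup>2 = of_bool (i \<in> sym_diff A (p A))" for i by (auto simp: a_def)
    then have "(\<Sum>i\<in>I. (a A i)\<^sup>2) = (\<Sum>i\<in>I. 1 * of_bool (i \<in> sym_diff A (p A)))" by simp
    also have "\<dots> = real (card (sym_diff A (p A)))"
      using bool_sum[OF sub, of "\<lambda>_. 1"] by simp
    finally show "(\<Sum>i\<in>I. (a A i)\<^sup>2) \<le> d" using p(2)[OF A] by simp
  qed
  ultimately show ?thesis by linarith
qed

text \<open>Lengths are square roots of symmetric differences, so dividing the scale by 4 halves the
  length of a link. With \<open>s = sqrt (D * n)\<close>, the step from level \<open>j\<close> to
  \<open>Suc j\<close> costs \<open>s * (3 * j + 9) / 2 ^ j\<close>. These costs sum to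
  \<open>24 * s\<close>, and the coarsest level adds \<open>2 * s\<close>.\<close>

lemma sum_signs_Max_vc_le:
  assumes I: "finite I" "card I \<ge> 1" and F: "F \<subseteq> Pow I" "F \<noteq> {}" and D1: "D \<ge> 1"
    and D: "\<And>B. B \<subseteq> I \<Longrightarrow> shatters F B \<Longrightarrow> card B \<le> D"
  shows "(\<Sum>\<epsilon>\<in>signs I. MAX A\<in>F. \<bar>\<Sum>i\<in>A. \<epsilon> i\<bar>) \<le> 2 ^ card I * (26 * sqrt (real D * card I))"
proof -
  define n where "n = card I"
  define X where "X T = (\<Sum>\<epsilon>\<in>signs I. MAX A\<in>T. \<bar>\<Sum>i\<in>A. \<epsilon> i\<bar>) / 2 ^ n" for T :: "'a set set"
  define s where "s = sqrt (real D * real n)"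
  have n: "n \<ge> 1" using I by (simp add: n_def)
  have finF: "finite F" using F I by (meson finite_Pow_iff finite_subset)
  have "\<exists>T\<subseteq>F. (\<forall>A\<in>T. \<forall>B\<in>T. A \<noteq> B \<longrightarrow> n / 4 ^ j < card (sym_diff A B)) \<and>
    (\<forall>A\<in>F. \<exists>B\<in>T. card (sym_diff A B) \<le> n / 4 ^ j)" for j :: nat
    by (rule exists_separated_net[OF finF]) simp
  then obtain T where T: "\<And>j. T j \<subseteq> F"
    "\<And>j A B. A \<in> T j \<Longrightarrow> B \<in> T j \<Longrightarrow> A \<noteq> B \<Longrightarrow> n / 4 ^ j < card (sym_diff A B)"
    "\<And>j A. A \<in> F \<Longrightarrow> \<exists>B\<in>T j. card (sym_diff A B) \<le> n / 4 ^ j"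
    by metis
  have fin: "finite (T j)" for j using T(1) finF finite_subset by blast
  have ne: "T j \<noteq> {}" for j using T(3) F by blast
  have sub: "T j \<subseteq> Pow I" for j using T(1) F by blast
  \<comment> \<open>At \<open>e = 1 / 4 ^ j\<close> the packing bound is
    \<open>4 * D * (j + 1) * ln 2 + 1 / 2\<close>. Here \<open>ln 2 \<le> 3 / 4\<close> gives
    \<open>D * (3 * j + 3)\<close>, and \<open>ln 2 + 1 / 2 \<le> 2 * D\<close> covers the
    remainder.\<close>
  have ln_card: "ln (2 * card (T j)) \<le> real D * (3 * real j + 5)" for j
  proof -
    have "ln (card (T j)) \<le> 2 * real D * ln (4 / (1 / 4 ^ j)) + 1 / 2"
    proof (rule ln_card_separated_le[OF I(1) fin sub ne])
      show "1 / 4 ^ j * real (card I) \<le> card (sym_diff A B)" if "A \<in> T j" "B \<in> T j" "A \<noteq> B" for A B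
        using T(2)[OF that] by (simp add: n_def)
      show "card B \<le> D" if "B \<subseteq> I" "shatters (T j) B" for B
        using that T(1) by (intro D shatters_mono[of "T j" B F])
    qed auto
    also have "4 / (1 / 4 ^ j) = (4::real) ^ Suc j" by simp
    also have "ln ((4::real) ^ Suc j) = Suc j * (2 * ln 2)"
    proof -
      have "ln (4::real) = ln (2 ^ 2)" by simp
      also have "\<dots> = 2 * ln 2" by (subst ln_realpow) auto
      finally show ?thesis by (subst ln_realpow) auto
    qed
    finally have "ln (card (T j)) \<le> 4 * real D * (Suc j * ln 2) + 1 / 2" by simp
    also have "\<dots> \<le> 4 * real D * (Suc j * (3 / 4)) + 1 / 2"
      using ln2_le_25_over_36 by (intro add_right_mono mult_left_mono) auto
    finally have "ln (card (T j)) \<le> real D * (3 * j + 3) + 1 / 2"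
      by (simp add: field_simps)
    moreover have "ln (2 * card (T j)) = ln 2 + ln (card (T j))"
      using ne fin by (simp add: ln_mult card_gt_0_iff)
    moreover have "ln (2::real) + 1 / 2 \<le> real D * 2" using D1 ln2_le_25_over_36 by linarith
    ultimately show ?thesis by (simp add: algebra_simps)
  qed
  have base: "X (T 0) \<le> 2 * s"
  proof -
    obtain A where A: "A \<in> T 0" using ne by auto
    \<comment> \<open>Two members of \<open>T 0\<close> would differ in more than \<open>n\<close>
      of the \<open>n\<close> points, so the chain starts at a single set.\<close>
    have "T 0 = {A}"
    proof (rule ccontr)
      assume "T 0 \<noteq> {A}"
      then obtain B where "B \<in> T 0" "A \<noteq> B" using A by auto
      then have "real n < card (sym_diff A B)" using T(2)[OF A, of B] by simp
      moreover have "card (sym_diff A B) \<le> n"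
        unfolding n_def using A sub \<open>B \<in> T 0\<close> I by (intro card_mono) auto
      ultimately show False by simp
    qed
    moreover have "A \<subseteq> I" using A sub by auto
    ultimately have "X (T 0) \<le> 2 * sqrt n"
      using sum_signs_abs_le[OF I(1) _ I(2), of A] by (simp add: X_def n_def field_simps)
    also have "\<dots> \<le> 2 * s"
    proof -
      have "1 * real n \<le> real D * real n" using D1 by (intro mult_right_mono) auto
      then show ?thesis unfolding s_def by simp
    qed
    finally show ?thesis .
  qed
  have step: "X (T (Suc j)) \<le> X (T j) + s / 2 ^ j * (3 * j + 9)" for j
  proof -
    define l where "l = s * 2 ^ j / n" \<comment> \<open>balances the two terms of the chaining step\<close>
    have s: "s > 0" "s * s = real D * n" using n D1 by (auto simp: s_def)
    have l: "l > 0" using s n by (simp add: l_def)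
    have net: "\<exists>B\<in>T j. card (sym_diff A B) \<le> real n / 4 ^ j" if "A \<in> T (Suc j)" for A
      using T(1,3) that by blast
    have "X (T (Suc j)) \<le> X (T j) + (ln (2 * card (T (Suc j))) / l + l * (n / 4 ^ j) / 2)"
      using chaining_step[OF I(1) fin sub fin ne sub net l] by (simp add: X_def n_def field_simps)
    also have "\<dots> \<le> X (T j) + (s / 2 ^ j * (3 * j + 8) + s / 2 ^ j)"
    proof (intro add_left_mono add_mono)
      have "ln (2 * card (T (Suc j))) / l \<le> real D * (3 * j + 8) / l"
        using ln_card[of "Suc j"] l by (intro divide_right_mono) (auto simp: algebra_simps)
      also have "\<dots> = real D / l * (3 * j + 8)" by simp
      also have "real D / l = s / 2 ^ j"
        using s n by (simp add: l_def field_simps)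
      finally show "ln (2 * card (T (Suc j))) / l \<le> s / 2 ^ j * (3 * j + 8)" .
      have "(4::real) ^ j = 2 ^ j * 2 ^ j" by (simp flip: power_mult_distrib)
      then have eq: "l * (n / 4 ^ j) / 2 = s / 2 ^ j / 2" using n by (simp add: l_def)
      have half: "q / 2 \<le> q" if "q \<ge> 0" for q :: real using that by simp
      show "l * (n / 4 ^ j) / 2 \<le> s / 2 ^ j"
        unfolding eq by (rule half) (use s in simp)
    qed
    also have "s / 2 ^ j * (3 * j + 8) + s / 2 ^ j = s / 2 ^ j * (3 * j + 9)"
      by (simp add: algebra_simps)
    finally show ?thesis .
  qed
  \<comment> \<open>\<open>(6 * j + 24) / 2 ^ j\<close> is the tail of the series of the increments \<open>(3 * j + 9) / 2 ^ j\<close>.\<close>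
  have bound: "X (T j) \<le> s * (26 - (6 * real j + 24) / 2 ^ j)" for j
  proof (induction j)
    case 0
    then show ?case using base by simp
  next
    case (Suc j)
    have "X (T (Suc j)) \<le> X (T j) + s / 2 ^ j * (3 * real j + 9)" using step[of j] by simp
    also have "\<dots> \<le> s * (26 - (6 * real j + 24) / 2 ^ j) + s / 2 ^ j * (3 * real j + 9)"
      by (rule add_right_mono) (rule Suc)
    also have "\<dots> = s * (26 - (6 * real (Suc j) + 24) / 2 ^ Suc j)"
      by (simp add: field_simps)
    finally show ?case .
  qed
  have "s * (26 - (6 * real n + 24) / 2 ^ n) \<le> s * 26"
    by (rule mult_left_mono) (simp_all add: s_def)
  with bound[of n] have XT: "X (T n) \<le> s * 26" by (rule order.trans)
  \<comment> \<open>The chain can stop at level \<open>n\<close>: the radius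
    \<open>n / 4 ^ n\<close> is below 1, so the net element near a set is the set itself.\<close>
  have "F \<subseteq> T n"
  proof
    fix A assume A: "A \<in> F"
    then obtain B where B: "B \<in> T n" "card (sym_diff A B) \<le> n / 4 ^ n" using T(3) by blast
    have "real n < 2 ^ n" by (rule of_nat_less_two_power)
    also have "\<dots> \<le> 4 ^ n" by (rule power_mono) simp_all
    finally have "real n < 4 ^ n" .
    then have "n / 4 ^ n < real 1" by simp
    with B(2) have "real (card (sym_diff A B)) < real 1" by (rule order.strict_trans1)
    then have "card (sym_diff A B) = 0" by (simp only: of_nat_less_iff less_one)
    moreover have "finite (sym_diff A B)"
    proof (rule finite_subset[OF _ I(1)])
      have "A \<subseteq> I" "B \<subseteq> I" using A B(1) F(1) sub by blast+
      then show "sym_diff A B \<subseteq> I" by blast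
    qed
    ultimately have "sym_diff A B = {}" by (simp only: card_0_eq)
    then have "A = B" by blast
    then show "A \<in> T n" using B(1) by (simp only:)
  qed
  then have "T n = F" using T(1) by blast
  then show ?thesis using XT by (simp add: X_def s_def n_def field_simps)
qed

section \<open>Symmetrization and the excess risk\<close>

text \<open>The sets of indices are error patterns. For fixed labels \<open>y\<close>, exclusive or
  with \<open>y\<close> is a bijection of patterns, so a family of error patterns shatters
  \<open>B\<close> only if the points \<open>x i\<close> with \<open>i\<close> in \<open>B\<close>
  are shattered by \<open>C\<close>. This carries the VC dimension from the classifiers to their
  losses.\<close>

lemma shattered_card_le_vc_dim:
  fixes x :: "'i \<Rightarrow> 'x" and y :: "'i \<Rightarrow> bool"
  assumes vc: "vc_dim S C = enat D" and B: "finite B" and x: "\<And>i. i \<in> B \<Longrightarrow> x i \<in> S"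
    and sh: "shatters ((\<lambda>A. {i\<in>I. y i \<noteq> (x i \<in> A)}) ` C) B" and BI: "B \<subseteq> I"
  shows "card B \<le> D"
proof (cases "card B = 0")
  case False
  define k where "k = card B"
  have k: "k \<ge> 1" using False by (simp add: k_def)
  obtain h where h: "bij_betw h {..<k} B"
    using ex_bij_betw_nat_finite[OF B] by (auto simp: k_def atLeast0LessThan)
  define tr where "tr u = (\<lambda>A. \<lambda>i\<in>{..<k}. u i \<in> A) ` C" for u :: "nat \<Rightarrow> 'x"
  define u where "u = (\<lambda>i\<in>{..<k}. x (h i))"
  have hB: "h i \<in> B" if "i < k" for i using h that by (auto simp: bij_betw_def)
  have u: "u \<in> {..<k} \<rightarrow>\<^sub>E S" unfolding u_def using x hB by auto
  have tr_sub: "tr v \<subseteq> {..<k} \<rightarrow>\<^sub>E UNIV" for v by (auto simp: tr_def)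
  have fin: "finite ({..<k} \<rightarrow>\<^sub>E (UNIV :: bool set))" by (intro finite_PiE) auto
  have card_all: "card ({..<k} \<rightarrow>\<^sub>E (UNIV :: bool set)) = 2 ^ k" by (simp add: card_PiE)
  have card_tr: "card (tr v) \<le> 2 ^ k" for v
    using card_mono[OF fin tr_sub[of v]] card_all by simp
  have "{..<k} \<rightarrow>\<^sub>E UNIV \<subseteq> tr u"
  proof
    fix f :: "nat \<Rightarrow> bool" assume f: "f \<in> {..<k} \<rightarrow>\<^sub>E UNIV"
    \<comment> \<open>\<open>E\<close> is the error pattern to ask for so that undoing the labels
      yields the prescribed memberships \<open>f\<close>.\<close>
    define E where "E = {b\<in>B. y b \<noteq> f (inv_into {..<k} h b)}"
    have "E \<subseteq> B" by (auto simp: E_def)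
    with sh obtain A' where "A' \<in> (\<lambda>A. {i\<in>I. y i \<noteq> (x i \<in> A)}) ` C" "A' \<inter> B = E"
      by (rule shattersE)
    then obtain A where A: "A \<in> C" "{i\<in>I. y i \<noteq> (x i \<in> A)} \<inter> B = E" by auto
    have "(u i \<in> A) = f i" if "i < k" for i
    proof -
      have "inv_into {..<k} h (h i) = i"
        using h that by (intro inv_into_f_f) (auto simp: bij_betw_def)
      then have "h i \<in> E \<longleftrightarrow> y (h i) \<noteq> f i" using hB[OF that] by (simp add: E_def)
      moreover have "h i \<in> E \<longleftrightarrow> y (h i) \<noteq> (x (h i) \<in> A)"
        using hB[OF that] BI unfolding A(2)[symmetric] by auto
      ultimately show ?thesis using that by (auto simp: u_def)
    qed
    then have "f = (\<lambda>i\<in>{..<k}. u i \<in> A)"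
      using f by (intro ext) (auto simp: PiE_def extensional_def)
    then show "f \<in> tr u" unfolding tr_def using A(1) by auto
  qed
  then have "tr u = {..<k} \<rightarrow>\<^sub>E UNIV" using tr_sub by blast
  then have "card (tr u) = 2 ^ k" using card_all by simp
  then have attained: "2 ^ k \<in> (\<lambda>v. card (tr v)) ` ({..<k} \<rightarrow>\<^sub>E S)"
    using u by (metis image_eqI)
  \<comment> \<open>There can be infinitely many tuples, but \<open>Max\<close> ranges over their
    counts, which form a finite set because each is at most \<open>2 ^ k\<close>.\<close>
  have "shatter_coeff S C k = 2 ^ k"
    unfolding shatter_coeff_def tr_def[symmetric]
  proof (intro Max_eqI)
    show "finite ((\<lambda>v. card (tr v)) ` ({..<k} \<rightarrow>\<^sub>E S))"
      by (rule finite_subset[of _ "{..2 ^ k}"]) (use card_tr in auto)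
  qed (use card_tr attained in auto)
  then have "enat k \<le> vc_dim S C"
    unfolding vc_dim_def using k by (intro Sup_upper) auto
  then show ?thesis using vc by (simp add: k_def)
qed simp

section \<open>Symmetrization for a fixed choice of signs\<close>

lemma integral_PiM_component:
  fixes f :: "'z \<Rightarrow> real"
  assumes "prob_space P" "i \<in> K" "f \<in> borel_measurable P"
  shows "(\<integral>y. f (y i) \<partial>PiM K (\<lambda>_. P)) = (\<integral>z. f z \<partial>P)"
proof -
  have "(\<integral>z. f z \<partial>P) = (\<integral>z. f z \<partial>distr (PiM K (\<lambda>_. P)) P (\<lambda>y. y i))"
    using assms by (subst distr_PiM_component) auto
  also have "\<dots> = (\<integral>y. f (y i) \<partial>PiM K (\<lambda>_. P))"
    using assms by (intro integral_distr) auto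
  finally show ?thesis ..
qed

text \<open>Jensen's inequality in the coordinates \<open>K\<close>, whose contribution has mean zero. Integrating
  out half of the sample itself, instead of a ghost sample, involves no suprema beyond the
  Rademacher supremum.\<close>

lemma half_sample_deviation_le:
  fixes f :: "'w \<Rightarrow> 'z \<Rightarrow> real" and \<epsilon> :: "'i \<Rightarrow> real"
  assumes P: "prob_space P" and meas: "\<And>w. w \<in> W \<Longrightarrow> f w \<in> borel_measurable P"
    and f01: "\<And>w z. 0 \<le> f w z" "\<And>w z. f w z \<le> 1"
    and JK: "finite J" "finite K" "J \<inter> K = {}"
    and \<sigma>: "\<bar>\<sigma>\<bar> = 1" "\<And>i. i \<in> J \<Longrightarrow> \<epsilon> i = \<sigma>" and \<epsilon>: "\<And>i. i \<in> K \<Longrightarrow> \<bar>\<epsilon> i\<bar> = 1"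
    and r: "r \<ge> 0" and w: "w \<in> W"
    and R: "\<And>z w. z \<in> space (PiM (J \<union> K) (\<lambda>_. P)) \<Longrightarrow> w \<in> W \<Longrightarrow>
      \<bar>r * (\<Sum>i\<in>J \<union> K. \<epsilon> i * f w (z i))\<bar> \<le> R z"
    and Rm: "R \<in> borel_measurable (PiM (J \<union> K) (\<lambda>_. P))"
    and x: "x \<in> space (PiM J (\<lambda>_. P))"
  shows "ennreal \<bar>r * (\<Sum>i\<in>J. f w (x i) - (\<integral>z. f w z \<partial>P))\<bar>
    \<le> (\<integral>\<^sup>+y. R (merge J K (x, y)) \<partial>PiM K (\<lambda>_. P)) + ennreal (r * \<bar>\<Sum>i\<in>J \<union> K. \<epsilon> i\<bar>)"
proof -
  interpret P: prob_space P by fact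
  interpret K: prob_space "PiM K (\<lambda>_. P)" by (intro prob_space_PiM P)
  define \<mu> where "\<mu> = (\<integral>z. f w z \<partial>P)"
  define m where "m y = merge J K (x, y)" for y
  \<comment> \<open>With \<open>x\<close> fixed, the \<open>J\<close> part of this centred signed
    sum is the deviation in question up to the sign \<open>\<sigma>\<close>, and the
    \<open>K\<close> part integrates to zero term by term.\<close>
  define h where "h y = r * (\<Sum>i\<in>J \<union> K. \<epsilon> i * (f w (m y i) - \<mu>))" for y
  have fm[measurable]: "f w \<in> borel_measurable P" using meas w by auto
  have \<mu>: "0 \<le> \<mu>" "\<mu> \<le> 1"
    unfolding \<mu>_def using f01
    by (auto intro!: integral_nonneg_AE P.integral_le_const P.integrable_const_bound[where B=1])
  have mm[measurable]: "m \<in> measurable (PiM K (\<lambda>_. P)) (PiM (J \<union> K) (\<lambda>_. P))"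
    unfolding m_def using x by measurable
  have R'[measurable]: "(\<lambda>y. R (m y)) \<in> borel_measurable (PiM K (\<lambda>_. P))"
    using measurable_comp[OF mm Rm] by (simp add: comp_def)
  have intK: "integrable (PiM K (\<lambda>_. P)) (\<lambda>y. f w (y i))" if "i \<in> K" for i
  proof (rule K.integrable_const_bound[where B=1])
    show "(\<lambda>y. f w (y i)) \<in> borel_measurable (PiM K (\<lambda>_. P))" using that by measurable
  qed (use f01 in auto)
  have h_eq: "h y = r * (\<Sum>i\<in>J. \<epsilon> i * (f w (x i) - \<mu>)) + r * (\<Sum>i\<in>K. \<epsilon> i * (f w (y i) - \<mu>))" for y
  proof -
    have "(\<Sum>i\<in>J. \<epsilon> i * (f w (m y i) - \<mu>)) = (\<Sum>i\<in>J. \<epsilon> i * (f w (x i) - \<mu>))"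
      by (intro sum.cong) (auto simp: m_def merge_def)
    moreover have "(\<Sum>i\<in>K. \<epsilon> i * (f w (m y i) - \<mu>)) = (\<Sum>i\<in>K. \<epsilon> i * (f w (y i) - \<mu>))"
      using JK by (intro sum.cong) (auto simp: m_def merge_def)
    ultimately show ?thesis
      unfolding h_def using JK by (simp add: sum.union_disjoint distrib_left)
  qed
  have inth: "integrable (PiM K (\<lambda>_. P)) h"
    unfolding h_eq using intK by auto
  have "(\<integral>y. h y \<partial>PiM K (\<lambda>_. P)) = r * (\<Sum>i\<in>J. \<epsilon> i * (f w (x i) - \<mu>))
      + r * (\<Sum>i\<in>K. \<epsilon> i * ((\<integral>y. f w (y i) \<partial>PiM K (\<lambda>_. P)) - \<mu>))"
    unfolding h_eq using intK by (simp add: K.prob_space)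
  also have "(\<Sum>i\<in>K. \<epsilon> i * ((\<integral>y. f w (y i) \<partial>PiM K (\<lambda>_. P)) - \<mu>)) = 0"
    using P by (intro sum.neutral) (auto simp: \<mu>_def integral_PiM_component)
  also have "(\<Sum>i\<in>J. \<epsilon> i * (f w (x i) - \<mu>)) = \<sigma> * (\<Sum>i\<in>J. f w (x i) - \<mu>)"
    unfolding sum_distrib_left using \<sigma> by (intro sum.cong) auto
  finally have inteq: "(\<integral>y. h y \<partial>PiM K (\<lambda>_. P)) = r * (\<sigma> * (\<Sum>i\<in>J. f w (x i) - \<mu>))" by simp
  have "ennreal \<bar>r * (\<Sum>i\<in>J. f w (x i) - \<mu>)\<bar> = ennreal (norm (\<integral>y. h y \<partial>PiM K (\<lambda>_. P)))"
    unfolding inteq using \<sigma> by (simp add: abs_mult)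
  also have "\<dots> \<le> (\<integral>\<^sup>+y. norm (h y) \<partial>PiM K (\<lambda>_. P))"
    by (rule integral_norm_bound_ennreal[OF inth])
  also have "\<dots> \<le> (\<integral>\<^sup>+y. ennreal (R (m y)) + ennreal (r * \<bar>\<Sum>i\<in>J \<union> K. \<epsilon> i\<bar>) \<partial>PiM K (\<lambda>_. P))"
  proof (rule nn_integral_mono)
    fix y assume "y \<in> space (PiM K (\<lambda>_. P))"
    then have my: "m y \<in> space (PiM (J \<union> K) (\<lambda>_. P))" by (rule measurable_space[OF mm])
    \<comment> \<open>\<open>R\<close> bounds the uncentred sum only. Removing the centring costs
      \<open>\<mu>\<close> times the imbalance of the signs, and
      \<open>0 \<le> \<mu> \<le> 1\<close>.\<close>
    have "h y = r * (\<Sum>i\<in>J \<union> K. \<epsilon> i * f w (m y i)) - r * (\<Sum>i\<in>J \<union> K. \<epsilon> i) * \<mu>"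
      by (simp add: h_def right_diff_distrib sum_subtractf sum_distrib_right)
    then have "\<bar>h y\<bar> \<le> \<bar>r * (\<Sum>i\<in>J \<union> K. \<epsilon> i * f w (m y i))\<bar> + \<bar>r * (\<Sum>i\<in>J \<union> K. \<epsilon> i) * \<mu>\<bar>"
      by linarith
    also have "\<bar>r * (\<Sum>i\<in>J \<union> K. \<epsilon> i) * \<mu>\<bar> \<le> r * \<bar>\<Sum>i\<in>J \<union> K. \<epsilon> i\<bar>"
      using r \<mu> by (simp add: abs_mult mult_left_le)
    finally have "\<bar>h y\<bar> \<le> R (m y) + r * \<bar>\<Sum>i\<in>J \<union> K. \<epsilon> i\<bar>" using R[OF my w] by linarith
    moreover have "0 \<le> R (m y)" using R[OF my w] by linarith
    ultimately show "ennreal (norm (h y)) \<le> ennreal (R (m y)) + ennreal (r * \<bar>\<Sum>i\<in>J \<union> K. \<epsilon> i\<bar>)"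
      using r by (simp flip: ennreal_plus)
  qed
  also have "\<dots> = (\<integral>\<^sup>+y. ennreal (R (m y)) \<partial>PiM K (\<lambda>_. P)) + ennreal (r * \<bar>\<Sum>i\<in>J \<union> K. \<epsilon> i\<bar>)"
    by (subst nn_integral_add) (auto simp: K.emeasure_space_1)
  finally show ?thesis by (simp add: m_def \<mu>_def)
qed

text \<open>The signs are constant on each half, so each half in turn can play the part of
  \<open>J\<close> in the preceding lemma. Either use costs one integral of \<open>R\<close> and one
  imbalance term, whence the two factors 2.\<close>

lemma fixed_sign_symmetrization:
  fixes f :: "'w \<Rightarrow> 'z \<Rightarrow> real" and \<epsilon> :: "'i \<Rightarrow> real"
  assumes P: "prob_space P" and meas: "\<And>w. w \<in> W \<Longrightarrow> f w \<in> borel_measurable P"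
    and f01: "\<And>w z. 0 \<le> f w z" "\<And>w z. f w z \<le> 1"
    and I: "finite I" "I \<noteq> {}" and W: "W \<noteq> {}" and \<epsilon>: "\<epsilon> \<in> signs I"
  defines "G \<equiv> \<lambda>z. SUP w\<in>W. \<bar>1 / card I * (\<Sum>i\<in>I. f w (z i)) - (\<integral>z. f w z \<partial>P)\<bar>"
    and "R \<equiv> \<lambda>z. SUP w\<in>W. \<bar>1 / card I * (\<Sum>i\<in>I. \<epsilon> i * f w (z i))\<bar>"
  assumes Gm: "G \<in> borel_measurable (PiM I (\<lambda>_. P))" and Rm: "R \<in> borel_measurable (PiM I (\<lambda>_. P))"
  shows "integrable (PiM I (\<lambda>_. P)) G" (is ?intG)
    and "integrable (PiM I (\<lambda>_. P)) R" (is ?intR)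
    and "(\<integral>z. G z \<partial>PiM I (\<lambda>_. P)) \<le> 2 * (\<integral>z. R z \<partial>PiM I (\<lambda>_. P)) + 2 * (\<bar>\<Sum>i\<in>I. \<epsilon> i\<bar> / card I)"
proof -
  interpret P: prob_space P by fact
  interpret I: prob_space "PiM I (\<lambda>_. P)" by (intro prob_space_PiM P)
  interpret PS: product_sigma_finite "\<lambda>_::'i. P" by unfold_locales
  define r where "r = 1 / real (card I)"
  define \<mu> where "\<mu> w = (\<integral>z. f w z \<partial>P)" for w
  have cI: "card I > 0" using I by (simp add: card_gt_0_iff)
  have r: "r \<ge> 0" "r * card I = 1" using cI by (auto simp: r_def)
  have \<mu>: "0 \<le> \<mu> w" "\<mu> w \<le> 1" if "w \<in> W" for w
    unfolding \<mu>_def using f01 meas[OF that]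
    by (auto intro!: integral_nonneg_AE P.integral_le_const P.integrable_const_bound[where B=1])
  have \<epsilon>1: "\<bar>\<epsilon> i\<bar> = 1" if "i \<in> I" for i
    using PiE_mem[OF \<epsilon> that] by auto
  have dev_le: "\<bar>r * (\<Sum>i\<in>I. f w (z i)) - \<mu> w\<bar> \<le> 1" if "w \<in> W" for w z
  proof -
    have "r * (\<Sum>i\<in>I. f w (z i)) \<le> r * (\<Sum>i\<in>I. 1)"
      using f01 r by (intro mult_left_mono sum_mono) auto
    moreover have "0 \<le> r * (\<Sum>i\<in>I. f w (z i))" using f01 r by (intro mult_nonneg_nonneg sum_nonneg) auto
    ultimately show ?thesis using \<mu>[OF that] r by simp
  qed
  have rad_le: "\<bar>r * (\<Sum>i\<in>I. \<epsilon> i * f w (z i))\<bar> \<le> 1" for w z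
  proof -
    have "\<bar>\<Sum>i\<in>I. \<epsilon> i * f w (z i)\<bar> \<le> (\<Sum>i\<in>I. 1)"
      using f01 \<epsilon>1 by (intro order.trans[OF sum_abs] sum_mono) (simp add: abs_mult)
    then have "r * \<bar>\<Sum>i\<in>I. \<epsilon> i * f w (z i)\<bar> \<le> r * card I"
      using r by (intro mult_left_mono) auto
    then show ?thesis using r by (simp add: abs_mult)
  qed
  have G_eq: "G z = (SUP w\<in>W. \<bar>r * (\<Sum>i\<in>I. f w (z i)) - \<mu> w\<bar>)" for z
    by (simp add: G_def r_def \<mu>_def)
  have R_eq: "R z = (SUP w\<in>W. \<bar>r * (\<Sum>i\<in>I. \<epsilon> i * f w (z i))\<bar>)" for z
    by (simp add: R_def r_def)
  have R_ge: "\<bar>r * (\<Sum>i\<in>I. \<epsilon> i * f w (z i))\<bar> \<le> R z" if "w \<in> W" for w z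
    unfolding R_eq using that rad_le by (intro cSUP_upper bdd_aboveI2[where M=1]) auto
  have G_ge: "\<bar>r * (\<Sum>i\<in>I. f w (z i)) - \<mu> w\<bar> \<le> G z" if "w \<in> W" for w z
    unfolding G_eq using that dev_le by (intro cSUP_upper bdd_aboveI2[where M=1]) auto
  have R01: "0 \<le> R z" "R z \<le> 1" for z
  proof -
    show "R z \<le> 1" unfolding R_eq using W rad_le by (intro cSUP_least) auto
    obtain w where "w \<in> W" using W by auto
    from R_ge[OF this, of z] show "0 \<le> R z" by linarith
  qed
  have G01: "0 \<le> G z" "G z \<le> 1" for z
  proof -
    show "G z \<le> 1" unfolding G_eq using W dev_le by (intro cSUP_least) auto
    obtain w where "w \<in> W" using W by auto
    from G_ge[OF this, of z] show "0 \<le> G z" by linarith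
  qed
  show intG: ?intG by (rule I.integrable_const_bound[where B=1]) (use G01 Gm in auto)
  show intR: ?intR by (rule I.integrable_const_bound[where B=1]) (use R01 Rm in auto)
  define J where "J = {i\<in>I. \<epsilon> i = 1}"
  define K where "K = {i\<in>I. \<epsilon> i = -1}"
  have JK: "finite J" "finite K" "J \<inter> K = {}" "J \<union> K = I" "K \<inter> J = {}" "K \<union> J = I"
    using I \<epsilon> by (auto simp: J_def K_def)
  define \<delta> where "\<delta> = r * \<bar>\<Sum>i\<in>I. \<epsilon> i\<bar>"
  \<comment> \<open>\<open>BJ\<close> depends on the \<open>J\<close> coordinates only,
    \<open>BK\<close> on the \<open>K\<close> coordinates only, and neither on \<open>w\<close>.
    Hence the supremum over \<open>w\<close> can be taken before integrating, and the iterated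
    integral of \<open>BJ x + BK y\<close> splits.\<close>
  define BJ where "BJ x = (\<integral>\<^sup>+y. R (merge J K (x, y)) \<partial>PiM K (\<lambda>_. P)) + ennreal \<delta>" for x
  define BK where "BK y = (\<integral>\<^sup>+x. R (merge K J (y, x)) \<partial>PiM J (\<lambda>_. P)) + ennreal \<delta>" for y
  interpret J: prob_space "PiM J (\<lambda>_. P)" by (intro prob_space_PiM P)
  interpret K: prob_space "PiM K (\<lambda>_. P)" by (intro prob_space_PiM P)
  have RmJK: "R \<in> borel_measurable (PiM (J \<union> K) (\<lambda>_. P))" "R \<in> borel_measurable (PiM (K \<union> J) (\<lambda>_. P))"
    using Rm JK by simp_all
  have mergeJK: "(\<lambda>p. R (merge J K p)) \<in> borel_measurable (PiM J (\<lambda>_. P) \<Otimes>\<^sub>M PiM K (\<lambda>_. P))"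
    using measurable_comp[OF measurable_merge RmJK(1)] by (simp add: comp_def)
  have mergeKJ: "(\<lambda>p. R (merge K J p)) \<in> borel_measurable (PiM K (\<lambda>_. P) \<Otimes>\<^sub>M PiM J (\<lambda>_. P))"
    using measurable_comp[OF measurable_merge RmJK(2)] by (simp add: comp_def)
  have BJm: "(\<lambda>x. \<integral>\<^sup>+y. R (merge J K (x, y)) \<partial>PiM K (\<lambda>_. P)) \<in> borel_measurable (PiM J (\<lambda>_. P))"
    by (rule K.borel_measurable_nn_integral_fst[of "\<lambda>p. ennreal (R (merge J K p))"])
      (use mergeJK in measurable)
  have BKm: "(\<lambda>y. \<integral>\<^sup>+x. R (merge K J (y, x)) \<partial>PiM J (\<lambda>_. P)) \<in> borel_measurable (PiM K (\<lambda>_. P))"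
    by (rule J.borel_measurable_nn_integral_fst[of "\<lambda>p. ennreal (R (merge K J p))"])
      (use mergeKJ in measurable)
  have intBJ: "(\<integral>\<^sup>+x. BJ x \<partial>PiM J (\<lambda>_. P)) = (\<integral>\<^sup>+z. R z \<partial>PiM I (\<lambda>_. P)) + ennreal \<delta>"
  proof -
    have "(\<integral>\<^sup>+x. BJ x \<partial>PiM J (\<lambda>_. P))
        = (\<integral>\<^sup>+x. \<integral>\<^sup>+y. R (merge J K (x, y)) \<partial>PiM K (\<lambda>_. P) \<partial>PiM J (\<lambda>_. P)) + (\<integral>\<^sup>+x. ennreal \<delta> \<partial>PiM J (\<lambda>_. P))"
      unfolding BJ_def using BJm by (rule nn_integral_add) simp
    then show ?thesis
      using PS.product_nn_integral_fold[of J K "\<lambda>z. ennreal (R z)"] JK RmJK(1)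
      by (simp add: J.emeasure_space_1)
  qed
  have intBK: "(\<integral>\<^sup>+y. BK y \<partial>PiM K (\<lambda>_. P)) = (\<integral>\<^sup>+z. R z \<partial>PiM I (\<lambda>_. P)) + ennreal \<delta>"
  proof -
    have "(\<integral>\<^sup>+y. BK y \<partial>PiM K (\<lambda>_. P))
        = (\<integral>\<^sup>+y. \<integral>\<^sup>+x. R (merge K J (y, x)) \<partial>PiM J (\<lambda>_. P) \<partial>PiM K (\<lambda>_. P)) + (\<integral>\<^sup>+y. ennreal \<delta> \<partial>PiM K (\<lambda>_. P))"
      unfolding BK_def using BKm by (rule nn_integral_add) simp
    then show ?thesis
      using PS.product_nn_integral_fold[of K J "\<lambda>z. ennreal (R z)"] JK RmJK(2)
      by (simp add: K.emeasure_space_1)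
  qed
  have G_le: "ennreal (G (merge J K (x, y))) \<le> BJ x + BK y"
    if x: "x \<in> space (PiM J (\<lambda>_. P))" and y: "y \<in> space (PiM K (\<lambda>_. P))" for x y
  \<comment> \<open>A conditionally complete supremum needs a real bound \<open>b\<close>; if the
    extended bound is infinite, there is nothing to show.\<close>
  proof (cases "BJ x + BK y")
    case (real b)
    have "\<bar>r * (\<Sum>i\<in>I. f w (merge J K (x, y) i)) - \<mu> w\<bar> \<le> b" if w: "w \<in> W" for w
    proof -
      have "(\<Sum>i\<in>I. f w (merge J K (x, y) i)) = (\<Sum>i\<in>J. f w (merge J K (x, y) i)) + (\<Sum>i\<in>K. f w (merge J K (x, y) i))"
        unfolding JK(4)[symmetric] using JK by (intro sum.union_disjoint)
      also have "(\<Sum>i\<in>J. f w (merge J K (x, y) i)) = (\<Sum>i\<in>J. f w (x i))"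
        by (intro sum.cong) (auto simp: merge_def)
      also have "(\<Sum>i\<in>K. f w (merge J K (x, y) i)) = (\<Sum>i\<in>K. f w (y i))"
        using JK by (intro sum.cong) (auto simp: merge_def)
      finally have split: "(\<Sum>i\<in>I. f w (merge J K (x, y) i)) = (\<Sum>i\<in>J. f w (x i)) + (\<Sum>i\<in>K. f w (y i))" .
      have "card I = card J + card K" unfolding JK(4)[symmetric] using JK by (intro card_Un_disjoint)
      then have "r * (card J * \<mu> w + card K * \<mu> w) = (r * card I) * \<mu> w" by (simp add: algebra_simps)
      then have "\<mu> w = r * (card J * \<mu> w + card K * \<mu> w)" using r by simp
      then have "r * (\<Sum>i\<in>I. f w (merge J K (x, y) i)) - \<mu> w
          = r * (\<Sum>i\<in>J. f w (x i) - \<mu> w) + r * (\<Sum>i\<in>K. f w (y i) - \<mu> w)"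
        unfolding split by (simp add: sum_subtractf algebra_simps)
      then have "ennreal \<bar>r * (\<Sum>i\<in>I. f w (merge J K (x, y) i)) - \<mu> w\<bar>
          \<le> ennreal (\<bar>r * (\<Sum>i\<in>J. f w (x i) - \<mu> w)\<bar> + \<bar>r * (\<Sum>i\<in>K. f w (y i) - \<mu> w)\<bar>)"
        by (intro ennreal_leI) linarith
      also have "\<dots> = ennreal \<bar>r * (\<Sum>i\<in>J. f w (x i) - \<mu> w)\<bar> + ennreal \<bar>r * (\<Sum>i\<in>K. f w (y i) - \<mu> w)\<bar>"
        by simp
      also have "\<dots> \<le> BJ x + BK y"
      proof (rule add_mono)
        show "ennreal \<bar>r * (\<Sum>i\<in>J. f w (x i) - \<mu> w)\<bar> \<le> BJ x"
          using half_sample_deviation_le[where f=f and W=W and J=J and K=K and \<sigma>=1 and \<epsilon>=\<epsilon> and r=r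
              and w=w and R=R and x=x, OF P meas f01 JK(1,2,3) _ _ _ r(1) w _ RmJK(1) x]
            R_ge \<epsilon>1 JK(4) by (auto simp: BJ_def \<delta>_def \<mu>_def J_def K_def)
        show "ennreal \<bar>r * (\<Sum>i\<in>K. f w (y i) - \<mu> w)\<bar> \<le> BK y"
          using half_sample_deviation_le[where f=f and W=W and J=K and K=J and \<sigma>="-1" and \<epsilon>=\<epsilon> and r=r
              and w=w and R=R and x=y, OF P meas f01 JK(2,1,5) _ _ _ r(1) w _ RmJK(2) y]
            R_ge \<epsilon>1 JK(6) by (auto simp: BK_def \<delta>_def \<mu>_def J_def K_def)
      qed
      finally show ?thesis using real by simp
    qed
    then have "G (merge J K (x, y)) \<le> b" unfolding G_eq using W by (intro cSUP_least) auto
    then show ?thesis using real by (simp add: ennreal_leI)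
  next
    case top
    then show ?thesis by (simp only: top_greatest)
  qed
  have "(\<integral>\<^sup>+z. G z \<partial>PiM I (\<lambda>_. P)) = (\<integral>\<^sup>+x. \<integral>\<^sup>+y. G (merge J K (x, y)) \<partial>PiM K (\<lambda>_. P) \<partial>PiM J (\<lambda>_. P))"
    using PS.product_nn_integral_fold[of J K "\<lambda>z. ennreal (G z)"] JK Gm by simp
  also have "\<dots> \<le> (\<integral>\<^sup>+x. \<integral>\<^sup>+y. BJ x + BK y \<partial>PiM K (\<lambda>_. P) \<partial>PiM J (\<lambda>_. P))"
    by (intro nn_integral_mono G_le)
  also have "\<dots> = (\<integral>\<^sup>+x. BJ x + (\<integral>\<^sup>+y. BK y \<partial>PiM K (\<lambda>_. P)) \<partial>PiM J (\<lambda>_. P))"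
  proof (rule nn_integral_cong)
    fix x
    have "(\<integral>\<^sup>+y. BJ x + BK y \<partial>PiM K (\<lambda>_. P)) = (\<integral>\<^sup>+y. BJ x \<partial>PiM K (\<lambda>_. P)) + (\<integral>\<^sup>+y. BK y \<partial>PiM K (\<lambda>_. P))"
      unfolding BK_def using BKm by (intro nn_integral_add) auto
    then show "(\<integral>\<^sup>+y. BJ x + BK y \<partial>PiM K (\<lambda>_. P)) = BJ x + (\<integral>\<^sup>+y. BK y \<partial>PiM K (\<lambda>_. P))"
      by (simp add: K.emeasure_space_1)
  qed
  also have "\<dots> = (\<integral>\<^sup>+x. BJ x \<partial>PiM J (\<lambda>_. P)) + (\<integral>\<^sup>+y. BK y \<partial>PiM K (\<lambda>_. P))"
  proof -
    have "(\<integral>\<^sup>+x. BJ x + c \<partial>PiM J (\<lambda>_. P)) = (\<integral>\<^sup>+x. BJ x \<partial>PiM J (\<lambda>_. P)) + (\<integral>\<^sup>+x. c \<partial>PiM J (\<lambda>_. P))" for c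
      unfolding BJ_def using BJm by (intro nn_integral_add) auto
    then show ?thesis by (simp add: J.emeasure_space_1)
  qed
  also have "\<dots> = ennreal (2 * (\<integral>z. R z \<partial>PiM I (\<lambda>_. P)) + 2 * \<delta>)"
  proof -
    have "(\<integral>\<^sup>+z. R z \<partial>PiM I (\<lambda>_. P)) = ennreal (\<integral>z. R z \<partial>PiM I (\<lambda>_. P))"
      using intR R01 by (intro nn_integral_eq_integral) auto
    moreover have "0 \<le> (\<integral>z. R z \<partial>PiM I (\<lambda>_. P))" using R01 by simp
    moreover have "0 \<le> \<delta>" using r by (simp add: \<delta>_def)
    ultimately show ?thesis unfolding intBJ intBK by (simp flip: ennreal_plus)
  qed
  also have "(\<integral>\<^sup>+z. G z \<partial>PiM I (\<lambda>_. P)) = ennreal (\<integral>z. G z \<partial>PiM I (\<lambda>_. P))"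
    using intG G01 by (intro nn_integral_eq_integral) auto
  finally have le: "ennreal (\<integral>z. G z \<partial>PiM I (\<lambda>_. P)) \<le> ennreal (2 * (\<integral>z. R z \<partial>PiM I (\<lambda>_. P)) + 2 * \<delta>)" .
  have "0 \<le> 2 * (\<integral>z. R z \<partial>PiM I (\<lambda>_. P)) + 2 * \<delta>"
    using R01 r by (auto simp: \<delta>_def intro!: add_nonneg_nonneg)
  from le[unfolded ennreal_le_iff[OF this]]
  show "(\<integral>z. G z \<partial>PiM I (\<lambda>_. P)) \<le> 2 * (\<integral>z. R z \<partial>PiM I (\<lambda>_. P)) + 2 * (\<bar>\<Sum>i\<in>I. \<epsilon> i\<bar> / card I)"
    by (simp add: \<delta>_def r_def)
qed

section \<open>The excess risk of the empirical risk minimizer\<close>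

theorem theorem0p5:
  "\<exists>c::real. 0 < c \<and> c \<le> universal_cap \<and>
    (\<forall>(M :: 'x measure) (N :: 'w measure) (\<phi> :: 'x \<Rightarrow> 'w \<Rightarrow> bool) (D :: nat)
      (P :: ('x \<times> bool) measure) (n :: nat)
      (Q :: 'o measure) (X :: nat \<Rightarrow> 'o \<Rightarrow> 'x) (Y :: nat \<Rightarrow> 'o \<Rightarrow> bool)
      (w_ERM :: (nat \<Rightarrow> 'x \<times> bool) \<Rightarrow> 'w).
        (\<forall>w\<in>space N. (\<lambda>x. \<phi> x w) \<in> measurable M (count_space UNIV)) \<longrightarrow>
        vc_dim (space M) (classifier_sets (space M) \<phi> (space N)) = enat D \<longrightarrow>
        n \<ge> 1 \<longrightarrow>
        prob_space P \<longrightarrow> sets P = sets (example_space M) \<longrightarrow>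
        prob_space Q \<longrightarrow>
        prob_space.indep_vars Q (\<lambda>_. example_space M) (\<lambda>i \<omega>. (X i \<omega>, Y i \<omega>)) {..<n} \<longrightarrow>
        (\<forall>i<n. distr Q (example_space M) (\<lambda>\<omega>. (X i \<omega>, Y i \<omega>)) = P) \<longrightarrow>
        measurable_suprema M P \<phi> (space N) n \<longrightarrow>
        w_ERM \<in> measurable (sample_space M n) N \<longrightarrow>
        risk P \<phi> \<in> borel_measurable N \<longrightarrow>
        (\<forall>z \<in> space (sample_space M n).
           is_arg_min (empirical_risk \<phi> n z) (\<lambda>w. w \<in> space N) (w_ERM z)) \<longrightarrow>
        prob_space.expectation Q
          (\<lambda>\<omega>. risk P \<phi> (w_ERM (\<lambda>i\<in>{..<n}. (X i \<omega>, Y i \<omega>))) - (INF w\<in>space N. risk P \<phi> w))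
          \<le> c * sqrt (real D / real n))"
proof (intro exI[of _ 112] conjI allI impI)
  fix M :: "'x measure" and N :: "'w measure" and \<phi> :: "'x \<Rightarrow> 'w \<Rightarrow> bool" and D :: nat
    and P :: "('x \<times> bool) measure" and n :: nat and Q :: "'o measure"
    and X :: "nat \<Rightarrow> 'o \<Rightarrow> 'x" and Y :: "nat \<Rightarrow> 'o \<Rightarrow> bool" and w_ERM :: "(nat \<Rightarrow> 'x \<times> bool) \<Rightarrow> 'w"
  assume \<phi>m: "\<forall>w\<in>space N. (\<lambda>x. \<phi> x w) \<in> measurable M (count_space UNIV)"
    and vc: "vc_dim (space M) (classifier_sets (space M) \<phi> (space N)) = enat D"
    and n: "n \<ge> 1" and P: "prob_space P" and setsP: "sets P = sets (example_space M)"
    and Q: "prob_space Q"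
    and indep: "prob_space.indep_vars Q (\<lambda>_. example_space M) (\<lambda>i \<omega>. (X i \<omega>, Y i \<omega>)) {..<n}"
    and distr: "\<forall>i<n. distr Q (example_space M) (\<lambda>\<omega>. (X i \<omega>, Y i \<omega>)) = P"
    and sup_meas: "measurable_suprema M P \<phi> (space N) n"
    and w_ERM: "w_ERM \<in> measurable (sample_space M n) N"
    and risk_meas: "risk P \<phi> \<in> borel_measurable N"
    and erm: "\<forall>z \<in> space (sample_space M n).
      is_arg_min (empirical_risk \<phi> n z) (\<lambda>w. w \<in> space N) (w_ERM z)"
  interpret P: prob_space P by fact
  interpret Q: prob_space Q by fact
  define W where "W = space N"
  define f where "f w z = zero_one_loss \<phi> z w" for w z
  define PM where "PM = PiM {..<n} (\<lambda>_. P)"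
  define S where "S \<omega> = (\<lambda>i\<in>{..<n}. (X i \<omega>, Y i \<omega>))" for \<omega>
  interpret PM: prob_space PM unfolding PM_def by (intro prob_space_PiM P)
  have spaceP: "space P = space M \<times> UNIV"
    using sets_eq_imp_space_eq[OF setsP] by (simp add: space_pair_measure)
  have setsPM: "sets PM = sets (sample_space M n)"
    unfolding PM_def using setsP by (intro sets_PiM_cong) auto
  have spacePM: "space PM = space (sample_space M n)"
    by (rule sets_eq_imp_space_eq[OF setsPM])
  have measPM: "measurable PM L = measurable (sample_space M n) L" for L :: "'l measure"
    by (rule measurable_cong_sets[OF setsPM refl])
  have XYm: "(\<lambda>\<omega>. (X i \<omega>, Y i \<omega>)) \<in> measurable Q (example_space M)" if "i < n" for i
    using indep that by (auto simp: Q.indep_vars_def)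
  have Sm: "S \<in> measurable Q (sample_space M n)"
    unfolding S_def using XYm by (intro measurable_restrict) auto
  have "distr Q (sample_space M n) S = PiM {..<n} (\<lambda>i. distr Q (example_space M) (\<lambda>\<omega>. (X i \<omega>, Y i \<omega>)))"
    unfolding S_def using indep XYm n
    by (subst Q.indep_vars_iff_distr_eq_PiM'[symmetric]) (auto simp: lessThan_empty_iff)
  also have "\<dots> = PM" unfolding PM_def using distr by (intro PiM_cong) auto
  finally have distrS: "distr Q (sample_space M n) S = PM" .
  have ERM_W: "w_ERM z \<in> W" if "z \<in> space PM" for z
    using measurable_space[OF w_ERM, of z] that by (simp add: W_def spacePM)
  have W: "W \<noteq> {}" using ERM_W PM.not_empty by blast
  have risk01: "0 \<le> risk P \<phi> w" "risk P \<phi> w \<le> 1" for w by (auto simp: risk_def)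
  define ex where "ex z = risk P \<phi> (w_ERM z) - (INF w\<in>W. risk P \<phi> w)" for z
  have inf01: "0 \<le> (INF w\<in>W. risk P \<phi> w)" "(INF w\<in>W. risk P \<phi> w) \<le> 1"
  proof -
    show "0 \<le> (INF w\<in>W. risk P \<phi> w)" using W risk01 by (intro cINF_greatest) auto
    obtain w where "w \<in> W" using W by auto
    then have "(INF w\<in>W. risk P \<phi> w) \<le> risk P \<phi> w"
      using risk01 by (intro cINF_lower bdd_belowI2[where m=0]) auto
    then show "(INF w\<in>W. risk P \<phi> w) \<le> 1" using risk01(2)[of w] by linarith
  qed
  have exm: "ex \<in> borel_measurable PM"
    unfolding ex_def measPM using measurable_comp[OF w_ERM risk_meas] by (simp add: comp_def)
  \<comment> \<open>Only the law of the sample matters. On the product space the coordinates can be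
    integrated separately.\<close>
  have "prob_space.expectation Q (\<lambda>\<omega>. ex (S \<omega>)) = (\<integral>z. ex z \<partial>PM)"
    unfolding distrS[symmetric] using Sm exm by (intro integral_distr[symmetric]) (auto simp: measPM)
  moreover have "(\<integral>z. ex z \<partial>PM) \<le> 112 * sqrt (real D / real n)"
  proof (cases "D = 0")
    case True
    \<comment> \<open>For \<open>D = 0\<close> the bound is 0, while the chaining bound requires
      \<open>D \<ge> 1\<close>. No single point is shattered, so all classifiers agree on
      \<open>space M\<close>, the risk is constant and the excess risk vanishes.\<close>
    have const: "\<phi> x w = \<phi> x w'" if x: "x \<in> space M" and w: "w \<in> W" "w' \<in> W" for x w w'
    proof (rule ccontr)
      assume neq: "\<phi> x w \<noteq> \<phi> x w'"
      have "card {0::nat} \<le> D"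
      \<comment> \<open>With the label \<open>False\<close>, the error pattern at the only index 0
        is membership of \<open>x\<close> itself.\<close>
      proof (rule shattered_card_le_vc_dim[OF vc, where x="\<lambda>_. x" and y="\<lambda>_. False" and I="{0}"])
        show "shatters ((\<lambda>A. {i \<in> {0::nat}. False \<noteq> (x \<in> A)}) `
            classifier_sets (space M) \<phi> (space N)) {0}"
          unfolding shatters_def
        proof (intro allI impI)
          fix C assume C: "C \<subseteq> {0::nat}"
          obtain v where v: "v \<in> W" "\<phi> x v \<longleftrightarrow> 0 \<in> C"
            using w neq by (cases "\<phi> x w \<longleftrightarrow> 0 \<in> C") auto
          let ?E = "{i \<in> {0::nat}. False \<noteq> (x \<in> {x \<in> space M. \<phi> x v})}"
          have "?E \<in> (\<lambda>A. {i \<in> {0::nat}. False \<noteq> (x \<in> A)}) ` classifier_sets (space M) \<phi> (space N)"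
            by (rule image_eqI[where x="{x \<in> space M. \<phi> x v}"])
              (use v(1) in \<open>auto simp: classifier_sets_def W_def\<close>)
          moreover have "?E \<inter> {0} = C"
            using C v(2) x by auto
          ultimately show "\<exists>A\<in>(\<lambda>A. {i \<in> {0::nat}. False \<noteq> (x \<in> A)}) `
              classifier_sets (space M) \<phi> (space N). A \<inter> {0} = C"
            by (rule bexI[rotated])
        qed
      qed (use x in auto)
      then show False using True by simp
    qed
    have Collect_eq: "{z \<in> space P. snd z \<noteq> \<phi> (fst z) w} = {z \<in> space P. snd z \<noteq> \<phi> (fst z) w'}"
      if "w \<in> W" "w' \<in> W" for w w'
    proof (rule Collect_cong, rule conj_cong[OF refl])
      fix z assume "z \<in> space P"
      then have "fst z \<in> space M" by (auto simp: spaceP)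
      from const[OF this that] show "(snd z \<noteq> \<phi> (fst z) w) = (snd z \<noteq> \<phi> (fst z) w')" by simp
    qed
    have "ex z = 0" if z: "z \<in> space PM" for z
    proof -
      have "(INF w\<in>W. risk P \<phi> w) = (INF w\<in>W. risk P \<phi> (w_ERM z))"
      proof (rule INF_cong[OF refl])
        fix w assume "w \<in> W"
        from Collect_eq[OF this ERM_W[OF z]] show "risk P \<phi> w = risk P \<phi> (w_ERM z)"
          unfolding risk_def by (rule arg_cong)
      qed
      then show ?thesis using W by (simp add: ex_def)
    qed
    then have "(\<integral>z. ex z \<partial>PM) = (\<integral>z. 0 \<partial>PM)" by (intro Bochner_Integration.integral_cong) auto
    then show ?thesis using True by simp
  next
    case False
    then have D: "D \<ge> 1" by simp
    have fm: "f w \<in> borel_measurable P" if "w \<in> W" for w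
    proof -
      have [measurable]: "(\<lambda>x. \<phi> x w) \<in> measurable M (count_space UNIV)" using \<phi>m that by (simp add: W_def)
      have "(\<lambda>z. of_bool (snd z \<noteq> \<phi> (fst z) w) :: real) \<in> borel_measurable (example_space M)"
        by measurable
      then show ?thesis
        unfolding f_def zero_one_loss_def using measurable_cong_sets[OF setsP refl] by blast
    qed
    have f01: "0 \<le> f w z" "f w z \<le> 1" for w z by (auto simp: f_def zero_one_loss_def)
    have risk_eq: "(\<integral>z. f w z \<partial>P) = risk P \<phi> w" if "w \<in> W" for w
    proof -
      have "(\<integral>z. f w z \<partial>P) = (\<integral>z. indicator {z \<in> space P. snd z \<noteq> \<phi> (fst z) w} z \<partial>P)"
        by (intro Bochner_Integration.integral_cong) (simp_all add: f_def zero_one_loss_def indicator_def)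
      also have "\<dots> = measure P ({z \<in> space P. snd z \<noteq> \<phi> (fst z) w} \<inter> space P)"
        by (rule Bochner_Integration.integral_indicator)
      also have "{z \<in> space P. snd z \<noteq> \<phi> (fst z) w} \<inter> space P = {z \<in> space P. snd z \<noteq> \<phi> (fst z) w}"
        by blast
      finally show ?thesis unfolding risk_def .
    qed
    define G where "G z = (SUP w\<in>W. \<bar>empirical_risk \<phi> n z w - risk P \<phi> w\<bar>)" for z
    define R where "R \<epsilon> z = (SUP w\<in>W. \<bar>(1 / real n) * (\<Sum>i<n. \<epsilon> i * f w (z i))\<bar>)" for \<epsilon> z
    have G_eq: "G = (\<lambda>z. SUP w\<in>W. \<bar>1 / card {..<n} * (\<Sum>i<n. f w (z i)) - (\<integral>z. f w z \<partial>P)\<bar>)"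
      by (auto simp: G_def empirical_risk_def f_def[symmetric] risk_eq intro!: ext SUP_cong)
    have R_eq: "R \<epsilon> = (\<lambda>z. SUP w\<in>W. \<bar>1 / card {..<n} * (\<Sum>i<n. \<epsilon> i * f w (z i))\<bar>)" for \<epsilon>
      by (auto simp: R_def)
    have Gm: "G \<in> borel_measurable PM"
      using sup_meas unfolding measurable_suprema_def G_def measPM W_def by blast
    have Rm: "R \<epsilon> \<in> borel_measurable PM" if "\<epsilon> \<in> signs {..<n}" for \<epsilon>
      using sup_meas that unfolding measurable_suprema_def R_def measPM W_def f_def by blast
    have n0: "{..<n} \<noteq> {}" using n by (auto simp: lessThan_empty_iff)
    have symm: "integrable PM G" "integrable PM (R \<epsilon>)"
      "(\<integral>z. G z \<partial>PM) \<le> 2 * (\<integral>z. R \<epsilon> z \<partial>PM) + 2 * (\<bar>\<Sum>i<n. \<epsilon> i\<bar> / n)"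
      if "\<epsilon> \<in> signs {..<n}" for \<epsilon>
      using fixed_sign_symmetrization[of P W f "{..<n}" \<epsilon>, OF P fm f01 finite_lessThan n0 W that
          Gm[unfolded G_eq PM_def] Rm[OF that, unfolded R_eq PM_def], folded G_eq R_eq[of \<epsilon>] PM_def]
      by simp_all
    have emp01: "0 \<le> empirical_risk \<phi> n z w" "empirical_risk \<phi> n z w \<le> 1" for z w
    proof -
      have "(\<Sum>i<n. f w (z i)) \<le> (\<Sum>i<n. 1)" using f01 by (intro sum_mono)
      then show "empirical_risk \<phi> n z w \<le> 1"
        using n by (simp add: empirical_risk_def f_def[symmetric] field_simps)
      show "0 \<le> empirical_risk \<phi> n z w"
        using f01 by (simp add: empirical_risk_def f_def[symmetric] sum_nonneg)
    qed
    have G_ge: "\<bar>empirical_risk \<phi> n z w - risk P \<phi> w\<bar> \<le> G z" if "w \<in> W" for z w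
      unfolding G_def
    proof (rule cSUP_upper[OF that], rule bdd_aboveI2)
      show "\<bar>empirical_risk \<phi> n z v - risk P \<phi> v\<bar> \<le> 1" for v
        using emp01[of z v] risk01[of v] by linarith
    qed
    have ex_le: "ex z \<le> 2 * G z" if z: "z \<in> space PM" for z
    proof -
      \<comment> \<open>The infimum of the risk need not be attained, so \<open>w_ERM z\<close> is
        compared with every \<open>w\<close>; each of the two passages between risk and empirical
        risk costs one \<open>G z\<close>.\<close>
      have "risk P \<phi> (w_ERM z) - 2 * G z \<le> (INF w\<in>W. risk P \<phi> w)"
      proof (rule cINF_greatest[OF W])
        fix w assume w: "w \<in> W"
        have "empirical_risk \<phi> n z (w_ERM z) \<le> empirical_risk \<phi> n z w"
          using erm z w unfolding spacePM W_def by (auto simp: is_arg_min_linorder)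
        then show "risk P \<phi> (w_ERM z) - 2 * G z \<le> risk P \<phi> w"
          using G_ge[OF w, of z] G_ge[OF ERM_W[OF z], of z] by linarith
      qed
      then show ?thesis by (simp add: ex_def)
    qed
    have chain: "(\<Sum>\<epsilon>\<in>signs {..<n}. R \<epsilon> z) \<le> 2 ^ n * (26 * sqrt (real D * n)) / n"
      if z: "z \<in> space PM" for z
    proof -
      \<comment> \<open>For a fixed sample, the supremum over a possibly infinite \<open>W\<close>
        reduces to a maximum over the finitely many error patterns.\<close>
      define F where "F = (\<lambda>w. {i\<in>{..<n}. snd (z i) \<noteq> \<phi> (fst (z i)) w}) ` W"
      have zM: "fst (z i) \<in> space M" if "i < n" for i
      proof -
        have "z i \<in> space P" using z that by (auto simp: PM_def space_PiM)
        then show ?thesis by (auto simp: spaceP)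
      qed
      have F: "F \<subseteq> Pow {..<n}" "F \<noteq> {}" using W by (auto simp: F_def)
      have finF: "finite F" using F(1) by (rule finite_subset) simp
      have F_eq: "F = (\<lambda>A. {i\<in>{..<n}. snd (z i) \<noteq> (fst (z i) \<in> A)}) ` classifier_sets (space M) \<phi> (space N)"
        unfolding F_def classifier_sets_def image_image W_def[symmetric]
        using zM by (intro image_cong) auto
      have "R \<epsilon> z \<le> (MAX A\<in>F. \<bar>\<Sum>i\<in>A. \<epsilon> i\<bar>) / n" for \<epsilon>
        unfolding R_def
      proof (rule cSUP_least[OF W])
        fix w assume w: "w \<in> W"
        define A where "A = {i\<in>{..<n}. snd (z i) \<noteq> \<phi> (fst (z i)) w}"
        have "(\<Sum>i<n. \<epsilon> i * f w (z i)) = (\<Sum>i<n. if snd (z i) \<noteq> \<phi> (fst (z i)) w then \<epsilon> i else 0)"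
          by (intro sum.cong) (auto simp: f_def zero_one_loss_def)
        also have "\<dots> = (\<Sum>i\<in>A. \<epsilon> i)"
          unfolding A_def by (intro sum.inter_filter[symmetric]) simp
        finally have eq: "(\<Sum>i<n. \<epsilon> i * f w (z i)) = (\<Sum>i\<in>A. \<epsilon> i)" .
        have "A \<in> F" using w by (auto simp: F_def A_def)
        then have "\<bar>\<Sum>i\<in>A. \<epsilon> i\<bar> \<le> (MAX A\<in>F. \<bar>\<Sum>i\<in>A. \<epsilon> i\<bar>)" using finF by (intro Max_ge) auto
        then show "\<bar>1 / real n * (\<Sum>i<n. \<epsilon> i * f w (z i))\<bar> \<le> (MAX A\<in>F. \<bar>\<Sum>i\<in>A. \<epsilon> i\<bar>) / n"
          unfolding eq by (simp add: abs_mult divide_right_mono)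
      qed
      then have "(\<Sum>\<epsilon>\<in>signs {..<n}. R \<epsilon> z) \<le> (\<Sum>\<epsilon>\<in>signs {..<n}. (MAX A\<in>F. \<bar>\<Sum>i\<in>A. \<epsilon> i\<bar>) / n)"
        by (intro sum_mono)
      also have "\<dots> = (\<Sum>\<epsilon>\<in>signs {..<n}. MAX A\<in>F. \<bar>\<Sum>i\<in>A. \<epsilon> i\<bar>) / n"
        by (simp add: sum_divide_distrib)
      also have "\<dots> \<le> 2 ^ n * (26 * sqrt (real D * n)) / n"
      proof (rule divide_right_mono)
        have "card B \<le> D" if "B \<subseteq> {..<n}" "shatters F B" for B
        proof (rule shattered_card_le_vc_dim[OF vc, where x="\<lambda>i. fst (z i)" and y="\<lambda>i. snd (z i)" and I="{..<n}"])
          show "finite B" using that(1) by (rule finite_subset) simp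
        qed (use that zM in \<open>auto simp: F_eq\<close>)
        from sum_signs_Max_vc_le[OF finite_lessThan _ F D this]
        show "(\<Sum>\<epsilon>\<in>signs {..<n}. MAX A\<in>F. \<bar>\<Sum>i\<in>A. \<epsilon> i\<bar>) \<le> 2 ^ n * (26 * sqrt (real D * n))"
          using n by simp
      qed simp
      finally show ?thesis .
    qed
    \<comment> \<open>The integral of \<open>G\<close> is the same for all signs, so the fixed-sign
      inequality can be averaged. Exchanging the finite sum with the integral then lets the chaining
      bound act at each sample separately.\<close>
    have "2 ^ n * (\<integral>z. G z \<partial>PM) = (\<Sum>\<epsilon>\<in>signs {..<n}. (\<integral>z. G z \<partial>PM))"
      by (simp add: card_signs)
    also have "\<dots> \<le> (\<Sum>\<epsilon>\<in>signs {..<n}. 2 * (\<integral>z. R \<epsilon> z \<partial>PM) + 2 * (\<bar>\<Sum>i<n. \<epsilon> i\<bar> / n))"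
      by (intro sum_mono symm(3))
    also have "\<dots> = 2 * (\<Sum>\<epsilon>\<in>signs {..<n}. \<integral>z. R \<epsilon> z \<partial>PM) + 2 * ((\<Sum>\<epsilon>\<in>signs {..<n}. \<bar>\<Sum>i<n. \<epsilon> i\<bar>) / n)"
      by (simp add: sum.distrib sum_distrib_left sum_divide_distrib)
    also have "(\<Sum>\<epsilon>\<in>signs {..<n}. \<integral>z. R \<epsilon> z \<partial>PM) = (\<integral>z. (\<Sum>\<epsilon>\<in>signs {..<n}. R \<epsilon> z) \<partial>PM)"
      using symm(2) by (intro Bochner_Integration.integral_sum[symmetric])
    also have "\<dots> \<le> 2 ^ n * (26 * sqrt (real D * n)) / n"
      using chain symm(2) by (intro PM.integral_le_const Bochner_Integration.integrable_sum) auto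
    also have "(\<Sum>\<epsilon>\<in>signs {..<n}. \<bar>\<Sum>i<n. \<epsilon> i\<bar>) \<le> 2 ^ n * (2 * sqrt n)"
      using sum_signs_abs_le[of "{..<n}" "{..<n}"] n by simp
    finally have "2 ^ n * (\<integral>z. G z \<partial>PM)
        \<le> 2 * (2 ^ n * (26 * sqrt (real D * n)) / n) + 2 * (2 ^ n * (2 * sqrt n) / n)"
      by (simp add: divide_right_mono)
    also have "\<dots> = 2 ^ n * (52 * (sqrt (real D * n) / n) + 4 * (sqrt n / n))"
      by (simp add: field_simps)
    finally have "(\<integral>z. G z \<partial>PM) \<le> 52 * (sqrt (real D * n) / n) + 4 * (sqrt n / n)" by simp
    also have "sqrt (real D * n) / n = sqrt (real D / n)"
      using n by (simp add: real_sqrt_mult real_sqrt_divide field_simps)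
    also have "sqrt n / n = sqrt (1 / n)"
      using n by (simp add: real_sqrt_divide field_simps)
    also have "sqrt (1 / n) \<le> sqrt (real D / n)"
      using D by (intro real_sqrt_le_mono divide_right_mono) auto
    \<comment> \<open>Here \<open>56 = 2 * 26 + 2 * 2\<close>, from chaining and from the imbalance
      of the signs; the passage from \<open>G\<close> to the excess risk doubles it to 112.\<close>
    finally have "(\<integral>z. G z \<partial>PM) \<le> 56 * sqrt (real D / n)" by simp
    moreover have "(\<integral>z. ex z \<partial>PM) \<le> (\<integral>z. 2 * G z \<partial>PM)"
    proof (rule integral_mono)
      show "integrable PM ex"
      proof (rule PM.integrable_const_bound[where B=1])
        show "AE z in PM. norm (ex z) \<le> 1"
          using risk01 inf01 by (intro AE_I2) (simp add: ex_def abs_le_iff, smt (verit))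
      qed (rule exm)
      \<comment> \<open>Integrability of \<open>G\<close> was obtained relative to a choice of
        signs, so some choice has to be exhibited.\<close>
      have "(\<lambda>i\<in>{..<n}. 1) \<in> signs {..<n}" by auto
      from symm(1)[OF this] show "integrable PM (\<lambda>z. 2 * G z)" by simp
    qed (rule ex_le)
    ultimately show ?thesis by simp
  qed
  ultimately show "prob_space.expectation Q
      (\<lambda>\<omega>. risk P \<phi> (w_ERM (\<lambda>i\<in>{..<n}. (X i \<omega>, Y i \<omega>))) - (INF w\<in>space N. risk P \<phi> w))
      \<le> 112 * sqrt (real D / real n)"
    by (simp add: ex_def S_def W_def)
qed (simp_all add: universal_cap_def)

end
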